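(* Let $n\geq 1$ and $\sigma\in S_n$. The graph $\mathcal{B}(\sigma)$ is toroidal if and only if $\sigma$ avoids all permutations $\pi\in S_m$ such that $m\leq 10$ and $\mathcal{B}(\pi)$ is not toroidal.
   Context: The length $\ell(\pi)$ of $\pi\in S_n$ is the minimum number of adjacent transpositions $(i\ i+1)$ whose product is $\pi$; equivalently, it is the number of inversions, i.e. pairs $i<j$ with $\pi(i)>\pi(j)$. For $\sigma,\tau\in S_n$ write $\sigma\prec\tau$ if $\ell(\sigma)<\ell(\tau)$ and there is a transposition $t=(i\ j)$ (not necessarily adjacent) with $\sigma=\tau t$. Bruhat order $\leq$ on $S_n$ is the reflexive transitive closure of $\prec$. The Bruhat graph of $S_n$ is the directed graph with vertex set $S_n$ and an edge $\sigma\to\tau$ whenever $\sigma\prec\tau$ (the difference $\ell(\tau)-\ell(\sigma)$ need not be $1$). For $\pi\in S_n$, the Bruhat graph $\mathcal{B}(\pi)$ is the induced subgraph on the vertices $\sigma\in S_n$ with $\sigma\leq\pi$ in Bruhat order. For $\pi\in S_k$ and $\tau\in S_n$ with $k\leq n$, $\tau$ contains $\pi$ if there are indices $1\leq i_1<\cdots<i_k\leq n$ such that for all $a,b$, $\tau(i_a)<\tau(i_b)$ if and only if $\pi(a)<\pi(b)$; otherwise (or if $k>n$) $\tau$ avoids $\pi$. A graph is toroidal if it can be drawn on the surface of a torus without edges crossing; for $\mathcal{B}(\sigma)$ this refers to the underlying undirected graph. (In particular planar graphs are toroidal.) *)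

theory Defs
  imports
    "HOL-Analysis.Analysis"
    "HOL-Combinatorics.Permutations"
    "Graph_Theory.Digraph_Component"
begin

text \<open>
  The symmetric group \<open>S\<^sub>n\<close> is the set of \<open>\<pi> :: nat \<Rightarrow> nat\<close> with \<open>\<pi> permutes {1..n}\<close>
  (so \<open>\<pi>\<close> is the identity outside \<open>{1..n}\<close>); the product is \<open>\<circ>\<close>, so \<open>(\<tau> t)(x) = \<tau>(t(x))\<close>.
\<close>

section \<open>Length\<close>

definition adjacent_word :: "nat list \<Rightarrow> nat \<Rightarrow> nat" where
  "adjacent_word ks = foldr (\<lambda>i f. Transposition.transpose i (i + 1) \<circ> f) ks id"

definition perm_length :: "nat \<Rightarrow> (nat \<Rightarrow> nat) \<Rightarrow> nat" where
  "perm_length n \<pi> = (LEAST l. \<exists>ks. length ks = l \<and> set ks \<subseteq> {1..<n} \<and> adjacent_word ks = \<pi>)"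

definition inversions :: "nat \<Rightarrow> (nat \<Rightarrow> nat) \<Rightarrow> (nat \<times> nat) set" where
  "inversions n \<pi> = {(i, j). i \<in> {1..n} \<and> j \<in> {1..n} \<and> i < j \<and> \<pi> i > \<pi> j}"

lemma adjacent_word_snoc:
  "adjacent_word (ks @ [i]) = adjacent_word ks \<circ> Transposition.transpose i (i + 1)"
proof -
  have "foldr (\<lambda>i f. Transposition.transpose i (i + 1) \<circ> f) ks g = adjacent_word ks \<circ> g" for g
    by (induction ks) (simp_all add: adjacent_word_def comp_assoc)
  then show ?thesis
    by (simp add: adjacent_word_def)
qed

lemma finite_inversions: "finite (inversions n \<pi>)"
  by (rule finite_subset[of _ "{1..n} \<times> {1..n}"]) (auto simp: inversions_def)

lemma inversions_id: "inversions n id = {}"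
  by (auto simp: inversions_def)

lemma card_inversions_comp_adjacent:
  assumes "i \<in> {1..<n}"
  shows "card (inversions n (\<pi> \<circ> Transposition.transpose i (i + 1)) - {(i, i + 1)})
       = card (inversions n \<pi> - {(i, i + 1)})"
proof (rule bij_betw_same_card)
  let ?s = "Transposition.transpose i (i + 1)"
  have s: "?s a = (if a = i then i + 1 else if a = i + 1 then i else a)" for a
    by (simp add: Transposition.transpose_def)
  have range: "?s a \<in> {1..n}" if "a \<in> {1..n}" for a
    using that assms unfolding s by auto
  have less: "?s a < ?s b \<and> (?s a, ?s b) \<noteq> (i, i + 1)" if "a < b" "(a, b) \<noteq> (i, i + 1)" for a b
    using that unfolding s by auto
  have sub: "map_prod ?s ?s ` (inversions n \<rho> - {(i, i + 1)})
      \<subseteq> inversions n (\<rho> \<circ> ?s) - {(i, i + 1)}" for \<rho> :: "nat \<Rightarrow> nat"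
    unfolding inversions_def using range less by (clarsimp simp del: add_Suc_right) force
  show "bij_betw (map_prod ?s ?s) (inversions n (\<pi> \<circ> ?s) - {(i, i + 1)})
      (inversions n \<pi> - {(i, i + 1)})"
    by (rule bij_betw_byWitness[where f' = "map_prod ?s ?s"])
      (use sub[of \<pi>] sub[of "\<pi> \<circ> ?s"] in \<open>auto simp: comp_assoc simp del: One_nat_def add_Suc_right\<close>)
qed

lemma card_inversions_adjacent_word:
  "set ks \<subseteq> {1..<n} \<Longrightarrow> card (inversions n (adjacent_word ks)) \<le> length ks"
proof (induction ks rule: rev_induct)
  case Nil
  have "adjacent_word [] = id" by (simp add: adjacent_word_def)
  then show ?case by (simp only: inversions_id card.empty)
next
  case (snoc i ks)
  let ?I = "inversions n (adjacent_word ks \<circ> Transposition.transpose i (i + 1))"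
  have "card ?I \<le> card (?I - {(i, i + 1)}) + 1"
    by (auto simp: card_Diff_singleton_if)
  also have "card (?I - {(i, i + 1)}) \<le> card (inversions n (adjacent_word ks))"
    using card_inversions_comp_adjacent[of i n "adjacent_word ks"] snoc.prems
    by (simp add: card_mono finite_inversions)
  finally show ?case
    using snoc unfolding adjacent_word_snoc by (simp add: comp_def)
qed

lemma ex_adjacent_word:
  assumes "\<pi> permutes {1..n}"
  shows "\<exists>ks. length ks = card (inversions n \<pi>) \<and> set ks \<subseteq> {1..<n} \<and> adjacent_word ks = \<pi>"
  using assms
proof (induction "card (inversions n \<pi>)" arbitrary: \<pi> rule: less_induct)
  case less
  show ?case
  proof (cases "\<exists>i\<in>{1..<n}. \<pi> i > \<pi> (i + 1)")
    case True
    then obtain i where i: "i \<in> {1..<n}" "\<pi> i > \<pi> (i + 1)" by blast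
    let ?\<rho> = "\<pi> \<circ> Transposition.transpose i (i + 1)"
    have mem: "(i, i + 1) \<in> inversions n \<pi>" "(i, i + 1) \<notin> inversions n ?\<rho>"
      using i by (auto simp: inversions_def)
    then have "card (inversions n ?\<rho>) = card (inversions n \<pi> - {(i, i + 1)})"
      using card_inversions_comp_adjacent[OF i(1), of \<pi>] by simp
    then have card: "card (inversions n \<pi>) = Suc (card (inversions n ?\<rho>))"
      using mem(1) card.remove[OF finite_inversions mem(1)] by simp
    have "?\<rho> permutes {1..n}"
      using i(1) by (intro permutes_compose[OF permutes_swap_id less.prems]) auto
    then obtain ks where ks: "length ks = card (inversions n ?\<rho>)" "set ks \<subseteq> {1..<n}"
        "adjacent_word ks = ?\<rho>"
      using less.hyps[of ?\<rho>] card by auto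
    have "adjacent_word (ks @ [i]) = \<pi>"
      using ks(3) by (simp add: adjacent_word_snoc comp_assoc del: One_nat_def add_Suc_right)
    then show ?thesis
      using ks i(1) card by (intro exI[of _ "ks @ [i]"]) auto
  next
    case False
    have "i \<in> {1..n} \<longrightarrow> i \<le> \<pi> i" for i
    proof (induction i)
      case (Suc i)
      show ?case
      proof
        assume Si: "Suc i \<in> {1..n}"
        show "Suc i \<le> \<pi> (Suc i)"
        proof (cases "i = 0")
          case True
          then show ?thesis using permutes_in_image[OF less.prems, of "Suc i"] Si by auto
        next
          case i0: False
          then have "\<pi> i \<le> \<pi> (Suc i)" using False Si i0 by (force simp: not_less)
          moreover have "\<pi> i \<noteq> \<pi> (Suc i)"
            using permutes_inj[OF less.prems] by (metis injD n_not_Suc_n)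
          ultimately show ?thesis using Suc Si i0 by auto
        qed
      qed
    qed simp
    then have "\<pi> = id"
      using permutes_natset_ge[OF less.prems] by blast
    then show ?thesis
      by (intro exI[of _ "[]"]) (simp add: adjacent_word_def inversions_id)
  qed
qed

lemma perm_length_eq_card_inversions:
  assumes "\<pi> permutes {1..n}"
  shows "perm_length n \<pi> = card (inversions n \<pi>)"
  unfolding perm_length_def
  by (rule Least_equality) (use ex_adjacent_word[OF assms] card_inversions_adjacent_word in auto)

section \<open>Bruhat order and Bruhat graphs\<close>

definition bruhat_step :: "nat \<Rightarrow> (nat \<Rightarrow> nat) \<Rightarrow> (nat \<Rightarrow> nat) \<Rightarrow> bool" where
  "bruhat_step n \<sigma> \<tau> \<longleftrightarrow> \<sigma> permutes {1..n} \<and> \<tau> permutes {1..n} \<and>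
     perm_length n \<sigma> < perm_length n \<tau> \<and>
     (\<exists>i\<in>{1..n}. \<exists>j\<in>{1..n}. i \<noteq> j \<and> \<sigma> = \<tau> \<circ> Transposition.transpose i j)"

definition bruhat_le :: "nat \<Rightarrow> (nat \<Rightarrow> nat) \<Rightarrow> (nat \<Rightarrow> nat) \<Rightarrow> bool" where
  "bruhat_le n = (bruhat_step n)\<^sup>*\<^sup>*"

definition full_bruhat_graph :: "nat \<Rightarrow> (nat \<Rightarrow> nat) pair_pre_digraph" where
  "full_bruhat_graph n =
     \<lparr> pverts = {\<sigma>. \<sigma> permutes {1..n}}, parcs = {(\<sigma>, \<tau>). bruhat_step n \<sigma> \<tau>} \<rparr>"

definition bruhat_graph ::
  "nat \<Rightarrow> (nat \<Rightarrow> nat) \<Rightarrow> (nat \<Rightarrow> nat, (nat \<Rightarrow> nat) \<times> (nat \<Rightarrow> nat)) pre_digraph" where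
  "bruhat_graph n \<pi> =
     induce_subgraph (with_proj (full_bruhat_graph n)) {\<sigma>. \<sigma> permutes {1..n} \<and> bruhat_le n \<sigma> \<pi>}"

section \<open>Pattern containment\<close>

text \<open>The index sequence \<open>i\<^sub>1 < \<dots> < i\<^sub>k\<close> forces \<open>k \<le> n\<close>.\<close>

definition contains_pattern :: "nat \<Rightarrow> (nat \<Rightarrow> nat) \<Rightarrow> nat \<Rightarrow> (nat \<Rightarrow> nat) \<Rightarrow> bool" where
  "contains_pattern n \<tau> k \<pi> \<longleftrightarrow>
     (\<exists>ix. strict_mono_on {1..k} ix \<and> ix ` {1..k} \<subseteq> {1..n} \<and>
        (\<forall>a\<in>{1..k}. \<forall>b\<in>{1..k}. \<tau> (ix a) < \<tau> (ix b) \<longleftrightarrow> \<pi> a < \<pi> b))"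

abbreviation avoids_pattern :: "nat \<Rightarrow> (nat \<Rightarrow> nat) \<Rightarrow> nat \<Rightarrow> (nat \<Rightarrow> nat) \<Rightarrow> bool" where
  "avoids_pattern n \<tau> k \<pi> \<equiv> \<not> contains_pattern n \<tau> k \<pi>"

section \<open>Drawings on surfaces\<close>

text \<open>Edges of the underlying undirected graph, as sets of end points; parallel and antiparallel
  arcs are identified.\<close>

definition undirected_edges :: "('a, 'b) pre_digraph \<Rightarrow> 'a set set" where
  "undirected_edges G = (\<lambda>e. {tail G e, head G e}) ` arcs G"

text \<open>
  A drawing of \<open>G\<close> in \<open>S\<close> without crossings: vertices are distinct points of \<open>S\<close>, and each edge is
  a simple arc in \<open>S\<close> joining its end points, which passes through no other vertex and meets
  another edge only in a common end point.
  This is meant for graphs without loops, as an arc has distinct end points.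
\<close>

definition drawing_in :: "'p::topological_space set \<Rightarrow> ('a, 'b) pre_digraph \<Rightarrow>
    ('a \<Rightarrow> 'p) \<Rightarrow> ('a set \<Rightarrow> real \<Rightarrow> 'p) \<Rightarrow> bool" where
  "drawing_in S G \<phi> \<gamma> \<longleftrightarrow>
     inj_on \<phi> (verts G) \<and> \<phi> ` verts G \<subseteq> S \<and>
     (\<forall>e\<in>undirected_edges G.
        arc (\<gamma> e) \<and> path_image (\<gamma> e) \<subseteq> S \<and>
        {pathstart (\<gamma> e), pathfinish (\<gamma> e)} = \<phi> ` e \<and>
        path_image (\<gamma> e) \<inter> \<phi> ` verts G = \<phi> ` e) \<and>
     (\<forall>e\<in>undirected_edges G. \<forall>f\<in>undirected_edges G. e \<noteq> f \<longrightarrow>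
        path_image (\<gamma> e) \<inter> path_image (\<gamma> f) = \<phi> ` (e \<inter> f))"

definition torus :: "(complex \<times> complex) set" where
  "torus = sphere 0 1 \<times> sphere 0 1"

definition toroidal :: "('a, 'b) pre_digraph \<Rightarrow> bool" where
  "toroidal G \<longleftrightarrow> (\<exists>\<phi> \<gamma>. drawing_in torus G \<phi> \<gamma>)"

end

theory Submission
  imports Defs
begin

text \<open>
  If \<open>\<sigma>\<close> contains \<open>\<pi>\<close>, permuting the positions of an occurrence of \<open>\<pi>\<close> embeds the Bruhat graph of
  \<open>\<pi>\<close> into that of \<open>\<sigma>\<close>; hence toroidality passes to patterns.

  Conversely, consider the support of \<open>\<sigma>\<close>, the set of simple transpositions in its reduced words.
  If it has at most four elements, all \<open>\<rho> \<le> \<sigma>\<close> fix every letter except at most eight, and the Bruhat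
  graph of \<open>\<sigma>\<close> embeds into that of the pattern on these letters. If it has at least five, then \<open>\<sigma>\<close>
  contains a pattern with at most ten letters whose support still has five elements, and the interval
  below such a pattern contains a Boolean lattice of rank five. So it remains to see that the
  5-cube is not toroidal.

  The 5-cube contains two disjoint subdivisions of \<open>K\<^sub>3\<^sub>,\<^sub>3\<close>. A compact connected subset of the torus
  whose loops have linearly dependent homotopy classes embeds into an annulus, and hence into the
  plane. Since loops with linearly independent classes intersect, of two disjoint such sets
  at least one is planar, whereas \<open>K\<^sub>3\<^sub>,\<^sub>3\<close> is not.
\<close>

section \<open>Nonplanarity of \<open>K\<^sub>3\<^sub>,\<^sub>3\<close>\<close>

text \<open>The proof never decides which Bruhat graphs are toroidal. The hypothesis makes every
  pattern on at most ten positions toroidal, so it suffices to find one such pattern that either is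
  not toroidal, a contradiction, or whose Bruhat graph contains a copy of that of \<sigma>. The
  constant ten is twice five: each element of the support costs at most two positions. Rank four
  would not do, because the 4-cube can be drawn on the torus. With 32 vertices and 80 edges, the
  5-cube is also excluded by Euler's formula. Working with the point sets of two disjoint subgraphs
  avoids faces and cellular embeddings altogether: the ingredients are the Jordan curve theorem, the
  lifting criterion for \<open>exp\<close> and Brouwer's fixed point theorem. The obstacle is that a
  connected subset of the torus may wrap around it and still be planar, as an essential circle
  shows; hence the dichotomy rests on linear dependence of homotopy classes, not on
  contractibility.\<close>

locale Jordan_curve =
  fixes C :: "complex set"
  assumes ex_simple_path: "\<exists>g. simple_path g \<and> pathfinish g = pathstart g \<and> path_image g = C"
begin

lemma inside_nonempty: "inside C \<noteq> {}"
  and open_inside: "open (inside C)"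
  and connected_inside: "Topological_Spaces.connected (inside C)"
  and bounded_inside: "bounded (inside C)"
  and open_outside: "open (outside C)"
  and connected_outside: "Topological_Spaces.connected (outside C)"
  and inside_outside: "inside C \<union> outside C = - C"
  and frontier_inside: "frontier (inside C) = C"
  and frontier_outside: "frontier (outside C) = C"
  using ex_simple_path Jordan_inside_outside by metis+

lemma connected_subset_inside_or_outside:
  assumes "Topological_Spaces.connected D" "D \<inter> C = {}"
  shows "D \<subseteq> inside C \<or> D \<subseteq> outside C"
proof -
  have "inside C \<inter> D = {} \<or> outside C \<inter> D = {}"
    using connectedD[OF assms(1) open_inside open_outside] inside_outside assms(2)
      inside_Int_outside[of C] by blast
  then show ?thesis using inside_outside assms(2) by blast
qed

lemma closure_subset_inside: "D \<subseteq> inside C \<Longrightarrow> closure D \<subseteq> inside C \<union> C"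
  using closure_mono[of D "inside C"] closure_Un_frontier[of "inside C"] frontier_inside by simp

lemma closure_subset_outside: "D \<subseteq> outside C \<Longrightarrow> closure D \<subseteq> outside C \<union> C"
  using closure_mono[of D "outside C"] closure_Un_frontier[of "outside C"] frontier_outside by simp

end

locale theta_curve =
  fixes c1 c2 c3 :: "real \<Rightarrow> complex" and a b :: complex
  assumes arcs: "arc c1" "arc c2" "arc c3"
    and start: "pathstart c1 = a" "pathstart c2 = a" "pathstart c3 = a"
    and finish: "pathfinish c1 = b" "pathfinish c2 = b" "pathfinish c3 = b"
    and Int: "path_image c1 \<inter> path_image c2 = {a, b}"
      "path_image c1 \<inter> path_image c3 = {a, b}"
      "path_image c2 \<inter> path_image c3 = {a, b}"
begin

lemma ends_distinct: "a \<noteq> b"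
  using arc_distinct_ends[OF arcs(1)] start finish by simp

lemma Jordan_curve_Un:
  assumes "arc c" "arc c'" "pathstart c = a" "pathstart c' = a" "pathfinish c = b" "pathfinish c' = b"
    "path_image c \<inter> path_image c' = {a, b}"
  shows "Jordan_curve (path_image c \<union> path_image c')"
proof
  have "simple_path (c +++ reversepath c')"
    using assms by (simp add: simple_path_join_loop_eq arc_reversepath)
  then show "\<exists>g. simple_path g \<and> pathfinish g = pathstart g \<and> path_image g = path_image c \<union> path_image c'"
    using assms by (intro exI[of _ "c +++ reversepath c'"]) (simp add: path_image_join)
qed

sublocale J12: Jordan_curve "path_image c1 \<union> path_image c2"
  using arcs start finish Int by (intro Jordan_curve_Un) simp_all

sublocale J13: Jordan_curve "path_image c1 \<union> path_image c3"
  using arcs start finish Int by (intro Jordan_curve_Un) simp_all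

sublocale J23: Jordan_curve "path_image c2 \<union> path_image c3"
  using arcs start finish Int by (intro Jordan_curve_Un) simp_all

text \<open>The arc \<open>c3\<close> cuts the inside of the curve formed by \<open>c1\<close> and
  \<open>c2\<close> in two. Each of the three complementary regions is bounded by only two of the
  arcs, and D lies in one region. Taking the closure allows D to consist of arcs without their ends
  on the theta curve.\<close>

lemma closure_component_inside:
  assumes D: "Topological_Spaces.connected D" "D \<inter> (path_image c1 \<union> path_image c2 \<union> path_image c3) = {}"
    and ne: "path_image c3 \<inter> inside (path_image c1 \<union> path_image c2) \<noteq> {}"
  shows "\<exists>c \<in> {c1, c2, c3}. closure D \<inter> path_image c \<subseteq> {a, b}"
proof -
  let ?C12 = "path_image c1 \<union> path_image c2" and ?C13 = "path_image c1 \<union> path_image c3"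
    and ?C23 = "path_image c2 \<union> path_image c3"
  have sp: "simple_path c1" "simple_path c2" "simple_path c3"
    using arcs by (simp_all add: arc_imp_simple_path)
  obtain
    split: "inside ?C13 \<union> inside ?C23 \<union> (path_image c3 - {a,b}) = inside ?C12"
    using split_inside_simple_closed_curve[OF sp(1) start(1) finish(1) sp(2) start(2) finish(2)
        sp(3) start(3) finish(3) ends_distinct Int ne] by blast
  have D3: "D \<inter> ?C12 = {}" "D \<inter> ?C13 = {}" "D \<inter> ?C23 = {}" using D(2) by blast+
  have ni: "inside ?C12 \<inter> ?C12 = {}"
    using inside_no_overlap[of ?C12] by blast
  consider "D \<subseteq> outside ?C12" | "D \<subseteq> inside ?C13" | "D \<subseteq> inside ?C23"
    using J12.connected_subset_inside_or_outside[OF D(1) D3(1)]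
  proof
    assume "D \<subseteq> inside ?C12"
    then consider "D = {}" | "D \<inter> inside ?C13 \<noteq> {}" | "D \<inter> inside ?C23 \<noteq> {}"
      using split D(2) by blast
    then show ?thesis
    proof cases
      case 2
      then have "\<not> D \<subseteq> outside ?C13" using inside_Int_outside[of ?C13] by blast
      then show ?thesis
        using that(2) J13.connected_subset_inside_or_outside[OF D(1) D3(2)] by blast
    next
      case 3
      then have "\<not> D \<subseteq> outside ?C23" using inside_Int_outside[of ?C23] by blast
      then show ?thesis
        using that(3) J23.connected_subset_inside_or_outside[OF D(1) D3(3)] by blast
    qed (use that in simp)
  qed (use that in blast)
  then show ?thesis
  proof cases
    case 1
    then have "closure D \<inter> path_image c3 \<subseteq> {a, b}"
      using J12.closure_subset_outside[OF 1] inside_Int_outside[of ?C12] split Int by blast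
    then show ?thesis by blast
  next
    case 2
    have "closure D \<inter> path_image c2 \<subseteq> {a, b}"
      using J13.closure_subset_inside[OF 2] split Int ni by blast
    then show ?thesis by blast
  next
    case 3
    have "closure D \<inter> path_image c1 \<subseteq> {a, b}"
      using J23.closure_subset_inside[OF 3] split Int ni by blast
    then show ?thesis by blast
  qed
qed

text \<open>
  If \<open>c3\<close> runs outside the closed curve \<open>c1 \<union> c2\<close>, then an inversion centred at a point inside that
  curve reduces the claim to the previous lemma.
\<close>

lemma closure_component:
  assumes D: "Topological_Spaces.connected D" "D \<inter> (path_image c1 \<union> path_image c2 \<union> path_image c3) = {}"
  shows "\<exists>c \<in> {c1, c2, c3}. closure D \<inter> path_image c \<subseteq> {a, b}"
proof (cases "path_image c3 \<inter> inside (path_image c1 \<union> path_image c2) = {}")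
  case False
  then show ?thesis using closure_component_inside[OF D] by blast
next
  case True
  let ?C12 = "path_image c1 \<union> path_image c2"
  obtain p where p: "p \<in> inside ?C12" using J12.inside_nonempty by blast
  have pn: "p \<notin> path_image c1" "p \<notin> path_image c2" "p \<notin> path_image c3"
    using p True inside_no_overlap[of ?C12] by blast+
  have D12: "D \<inter> ?C12 = {}" using D(2) by blast
  show ?thesis
  proof (cases "p \<in> D")
    case True': True
    then have "\<not> D \<subseteq> outside ?C12"
      using p inside_Int_outside[of ?C12] by blast
    then have "closure D \<subseteq> inside ?C12 \<union> ?C12"
      using J12.connected_subset_inside_or_outside[OF D(1) D12] J12.closure_subset_inside by blast
    then have "closure D \<inter> path_image c3 \<subseteq> {a, b}"
      using True Int by blast
    then show ?thesis by blast
  next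
    case pD: False
    \<comment> \<open>Since \<open>1 / 0 = 0\<close>, the inversion takes the value 0 exactly at p
      and is injective on the whole plane. The theta curve and D avoid p, the only point where
      continuity fails.\<close>
    define f where "f z = 1 / (z - p)" for z
    have cont: "continuous_on (- {p}) f"
      unfolding f_def by (intro continuous_intros) auto
    have inj: "inj f" unfolding f_def by (auto simp: inj_def field_simps)
    have sub: "S \<subseteq> - {p}" if "p \<notin> S" for S using that by auto
    have arcI: "arc (f \<circ> c)" if "arc c" "p \<notin> path_image c" for c
      using that cont inj unfolding arc_def
      by (auto intro!: path_continuous_image comp_inj_on continuous_on_subset[OF cont] intro: inj_on_subset)
    interpret T: theta_curve "f \<circ> c1" "f \<circ> c2" "f \<circ> c3" "f a" "f b"
      using arcs pn start finish Int
      by unfold_locales (auto simp: arcI pathstart_compose pathfinish_compose path_image_compose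
            image_Int[OF inj, symmetric])
    have im: "path_image (f \<circ> c1) \<union> path_image (f \<circ> c2) = f ` ?C12"
      by (simp add: path_image_compose image_Un)
    interpret J': Jordan_curve "f ` ?C12"
      using T.J12.Jordan_curve_axioms unfolding im .
    have conn_in: "Topological_Spaces.connected (f ` (inside ?C12 - {p}))"
      using J12.open_inside J12.connected_inside
      by (intro connected_continuous_image continuous_on_subset[OF cont] connected_open_delete) auto
    have po: "p \<notin> outside ?C12" using p inside_Int_outside[of ?C12] by blast
    have conn_out: "Topological_Spaces.connected (f ` outside ?C12)"
      using J12.connected_outside po
      by (intro connected_continuous_image continuous_on_subset[OF cont]) auto
    have dis: "f ` (inside ?C12 - {p}) \<inter> f ` ?C12 = {}" "f ` outside ?C12 \<inter> f ` ?C12 = {}"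
      unfolding image_Int[OF inj, symmetric]
      using inside_no_overlap[of ?C12] outside_no_overlap[of ?C12] by blast+
    \<comment> \<open>Values blow up near p, so the image of the inside cannot lie in the bounded
      component.\<close>
    have "\<not> bounded (f ` (inside ?C12 - {p}))"
    proof
      assume "bounded (f ` (inside ?C12 - {p}))"
      then obtain B where B: "B > 0" "\<And>z. z \<in> inside ?C12 - {p} \<Longrightarrow> norm (f z) \<le> B"
        unfolding bounded_pos by auto
      obtain e where e: "e > 0" "ball p e \<subseteq> inside ?C12"
        using J12.open_inside p open_contains_ball by blast
      define r where "r = min (e/2) (1 / (2*B))"
      have r: "0 < r" "r < e" "r < 1 / B" using e B by (auto simp: r_def min_def field_simps)
      have "p + of_real r \<in> inside ?C12 - {p}" using r e by (auto simp: subset_iff dist_norm)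
      from B(2)[OF this] have "1 / r \<le> B" using r by (simp add: f_def norm_divide)
      then show False using r B(1) by (simp add: field_simps)
    qed
    then have "\<not> f ` (inside ?C12 - {p}) \<subseteq> inside (f ` ?C12)"
      using bounded_subset[OF J'.bounded_inside] by blast
    then have in_out: "f ` (inside ?C12 - {p}) \<subseteq> outside (f ` ?C12)"
      using J'.connected_subset_inside_or_outside[OF conn_in dis(1)] by blast
    have out_in: "f ` outside ?C12 \<subseteq> inside (f ` ?C12)"
    proof (rule ccontr)
      assume "\<not> ?thesis"
      then have oo: "f ` outside ?C12 \<subseteq> outside (f ` ?C12)"
        using J'.connected_subset_inside_or_outside[OF conn_out dis(2)] by satx
      \<comment> \<open>Every nonzero w is a value of f. If both sides went to the outside, only 0,
        which stands for the point at infinity, could remain inside, and a single point is not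
        open.\<close>
      have "w = 0" if w: "w \<in> inside (f ` ?C12)" for w
      proof (rule ccontr)
        assume "w \<noteq> 0"
        define z where "z = p + 1 / w"
        have fw: "w = f z" "z \<noteq> p" using \<open>w \<noteq> 0\<close> by (auto simp add: f_def z_def)
        moreover have "z \<in> inside ?C12 \<union> outside ?C12 \<union> ?C12" using J12.inside_outside by blast
        moreover have "z \<notin> ?C12"
          using w inside_no_overlap[of "f ` ?C12"] unfolding fw(1) by blast
        ultimately have "w \<in> outside (f ` ?C12)"
          using oo in_out unfolding fw(1) by blast
        then show False using w inside_Int_outside[of "f ` ?C12"] by blast
      qed
      then have "inside (f ` ?C12) = {0}" using J'.inside_nonempty by blast
      then show False using J'.open_inside not_open_singleton[of "0::complex"] by simp
    qed
    define z where "z = c3 (1/2)"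
    have "inj_on c3 {0..1}" using arcs(3) by (simp add: arc_def)
    then have z: "z \<in> path_image c3" "z \<noteq> a" "z \<noteq> b"
      using start(3) finish(3)
      by (auto simp: z_def path_image_def pathstart_def pathfinish_def dest: inj_onD)
    then have "z \<notin> ?C12" using Int(2,3) by blast
    moreover have "z \<notin> inside ?C12" using True z(1) by blast
    ultimately have "z \<in> outside ?C12" using J12.inside_outside by blast
    then have ne: "path_image (f \<circ> c3) \<inter> inside (path_image (f \<circ> c1) \<union> path_image (f \<circ> c2)) \<noteq> {}"
      using z out_in unfolding im by (auto simp: path_image_compose)
    have D': "Topological_Spaces.connected (f ` D)"
      using D pD by (intro connected_continuous_image continuous_on_subset[OF cont]) auto
    have "f ` D \<inter> (path_image (f \<circ> c1) \<union> path_image (f \<circ> c2) \<union> path_image (f \<circ> c3)) = {}"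
      using D inj by (auto simp: path_image_compose inj_def)
    from T.closure_component_inside[OF D' this ne]
    obtain c where c: "c \<in> {c1, c2, c3}" "closure (f ` D) \<inter> f ` path_image c \<subseteq> {f a, f b}"
      by (auto simp: path_image_compose)
    have "closure D \<inter> path_image c \<subseteq> {a, b}"
    proof
      fix z assume z: "z \<in> closure D \<inter> path_image c"
      then have "z \<noteq> p" using c pn by auto
      then have "isCont f z" unfolding f_def by (intro continuous_intros) auto
      moreover obtain s where "\<And>n. s n \<in> D" "s \<longlonglongrightarrow> z"
        using z closure_sequential[of z D] by blast
      ultimately have "(\<lambda>n. f (s n)) \<longlonglongrightarrow> f z" "\<And>n. f (s n) \<in> f ` D"
        using isCont_tendsto_compose by blast+
      then have "f z \<in> closure (f ` D)"
        unfolding closure_sequential by (intro exI[of _ "\<lambda>n. f (s n)"]) simp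
      then have "f z \<in> {f a, f b}" using c(2) z by blast
      then show "z \<in> {a, b}" using inj by (auto simp: inj_def)
    qed
    then show ?thesis using c(1) by blast
  qed
qed

end

text \<open>
  A theta curve together with a point \<open>x\<close> joined to interior points of its three arcs. The arcs \<open>d i\<close>
  may meet each other: a connected set touching all three arcs already excludes the plane.
\<close>

locale K33_drawing =
  fixes K :: "'p::topological_space set" and a b x :: 'p and c d :: "nat \<Rightarrow> real \<Rightarrow> 'p"
  assumes c: "i < 3 \<Longrightarrow> arc (c i) \<and> pathstart (c i) = a \<and> pathfinish (c i) = b \<and> path_image (c i) \<subseteq> K"
    and d: "i < 3 \<Longrightarrow> arc (d i) \<and> pathstart (d i) = x \<and> pathfinish (d i) \<in> path_image (c i) - {a, b} \<and>
        path_image (d i) \<subseteq> K"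
    and cc: "i < 3 \<Longrightarrow> j < 3 \<Longrightarrow> i \<noteq> j \<Longrightarrow> path_image (c i) \<inter> path_image (c j) = {a, b}"
    and dc: "i < 3 \<Longrightarrow> j < 3 \<Longrightarrow> path_image (d i) \<inter> path_image (c j) \<subseteq> {pathfinish (d i)}"

definition K33_config :: "'p::topological_space set \<Rightarrow> bool" where
  "K33_config K \<longleftrightarrow> (\<exists>a b x c d. K33_drawing K a b x c d)"

lemma K33_config_image:
  assumes "K33_config K" and h: "continuous_on K h" "inj_on h K"
  shows "K33_config (h ` K)"
proof -
  from assms(1) obtain a b x c d where "K33_drawing K a b x c d"
    unfolding K33_config_def by blast
  then interpret K33_drawing K a b x c d .
  note cd = c d
  have ab: "a \<in> K" "b \<in> K" using cc[of 0 1] cd[of 0] by auto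
  have arcI: "arc (h \<circ> g)" if "arc g" "path_image g \<subseteq> K" for g
    using that h unfolding arc_def
    by (auto intro!: path_continuous_image comp_inj_on intro: continuous_on_subset inj_on_subset
        simp: path_image_def)
  have int: "h ` A \<inter> h ` B = h ` (A \<inter> B)" if "A \<subseteq> K" "B \<subseteq> K" for A B
    using inj_on_image_Int[OF h(2) that] by simp
  have "K33_drawing (h ` K) (h a) (h b) (h x) (\<lambda>i. h \<circ> c i) (\<lambda>i. h \<circ> d i)"
  proof
    fix i :: nat assume i: "i < 3"
    show "arc (h \<circ> c i) \<and> pathstart (h \<circ> c i) = h a \<and> pathfinish (h \<circ> c i) = h b \<and>
        path_image (h \<circ> c i) \<subseteq> h ` K"
      using cd[OF i] by (auto simp: arcI pathstart_compose pathfinish_compose path_image_compose)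
    show "arc (h \<circ> d i) \<and> pathstart (h \<circ> d i) = h x \<and>
        pathfinish (h \<circ> d i) \<in> path_image (h \<circ> c i) - {h a, h b} \<and> path_image (h \<circ> d i) \<subseteq> h ` K"
      using cd[OF i] ab inj_onD[OF h(2)]
      by (auto simp: arcI pathstart_compose pathfinish_compose path_image_compose)
    fix j :: nat assume j: "j < 3"
    have "h ` path_image (d i) \<inter> h ` path_image (c j) = h ` (path_image (d i) \<inter> path_image (c j))"
      using cd i j by (intro int) auto
    then show "path_image (h \<circ> d i) \<inter> path_image (h \<circ> c j) \<subseteq> {pathfinish (h \<circ> d i)}"
      using dc[OF i j] by (auto simp: pathfinish_compose path_image_compose)
    assume "i \<noteq> j"
    have "h ` path_image (c i) \<inter> h ` path_image (c j) = h ` (path_image (c i) \<inter> path_image (c j))"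
      using cd i j by (intro int) auto
    then show "path_image (h \<circ> c i) \<inter> path_image (h \<circ> c j) = {h a, h b}"
      using cc[OF i j \<open>i \<noteq> j\<close>] by (auto simp: path_image_compose)
  qed
  then show ?thesis unfolding K33_config_def by blast
qed

text \<open>The arcs \<open>d i\<close> without their far ends form a connected set through x that
  misses the theta curve. Its closure contains the far ends, one in the interior of each arc
  \<open>c i\<close>, which \<open>closure_component\<close> forbids.\<close>

lemma not_K33_config_complex: "\<not> K33_config (K :: complex set)"
proof
  assume "K33_config K"
  then obtain a b x c d where "K33_drawing K a b x c d"
    unfolding K33_config_def by blast
  then interpret K33_drawing K a b x c d .
  note cd = c d
  interpret theta_curve "c 0" "c 1" "c 2" a b
    using cd cc by unfold_locales auto
  define D where "D = (\<Union>i<3. d i ` {0..<1})"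
  have dcont: "continuous_on {0..1} (d i)" if "i < 3" for i
    using cd[OF that] arc_imp_path path_def by blast
  have "Topological_Spaces.connected (\<Union>((\<lambda>i. d i ` {0..<1}) ` {..<3}))"
  proof (rule connected_Union)
    show "Topological_Spaces.connected S" if "S \<in> (\<lambda>i. d i ` {0..<1}) ` {..<3}" for S
      using that by (auto intro!: connected_continuous_image intro: continuous_on_subset[OF dcont])
    have "x \<in> d i ` {0..<1}" if "i < 3" for i
      using cd[OF that] by (auto simp: pathstart_def intro!: image_eqI[of _ _ 0])
    then show "\<Inter> ((\<lambda>i. d i ` {0..<1}) ` {..<3}) \<noteq> {}" by blast
  qed
  then have D: "Topological_Spaces.connected D" by (simp add: D_def)
  have D_c: "D \<inter> path_image (c j) = {}" if j: "j < 3" for j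
  proof -
    have False if "i < 3" "t \<in> {0..<1}" "d i t \<in> path_image (c j)" for i t
    proof -
      have "d i t \<in> path_image (d i)" using that by (auto simp: path_image_def)
      then have "d i t = d i 1" using dc[OF that(1) j] that by (auto simp: pathfinish_def)
      moreover have "inj_on (d i) {0..1}" using cd[OF that(1)] by (simp add: arc_def)
      ultimately show False using that by (auto dest!: inj_onD[of _ _ t 1])
    qed
    then show ?thesis unfolding D_def by blast
  qed
  then have D0: "D \<inter> (path_image (c 0) \<union> path_image (c 1) \<union> path_image (c 2)) = {}"
    by (simp add: Int_Un_distrib)
  have cl: "pathfinish (d i) \<in> closure D" if "i < 3" for i
  proof -
    have "d i ` closure {0..<1} \<subseteq> closure D"
      using that dcont[OF that] closure_subset[of D]
      by (intro image_closure_subset) (auto simp: D_def)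
    then show ?thesis by (auto simp: pathfinish_def)
  qed
  have "\<exists>i\<in>{0, 1, 2}. closure D \<inter> path_image (c i) \<subseteq> {a, b}"
    using closure_component[OF D D0] by simp
  then obtain i where "i \<in> {0, 1, 2}" "closure D \<inter> path_image (c i) \<subseteq> {a, b}" by blast
  moreover from this(1) have "i < 3" by auto
  ultimately show False using cl[of i] cd[of i] by blast
qed

section \<open>Disjoint sets in the torus\<close>

text \<open>A path is a quotient map from the unit interval onto its image, and quotient maps
  transport local path connectedness. The lifting criterion for coverings asks for this
  property.\<close>

lemma locally_path_connected_path_image:
  fixes g :: "real \<Rightarrow> 'a::metric_space"
  assumes "path g"
  shows "locally path_connected (path_image g)"
  unfolding path_image_def
proof (rule locally_path_connected_quotient_image)
  show "locally path_connected {0..1::real}"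
    by (simp add: convex_imp_locally_path_connected)
  show "openin (top_of_set {0..1}) ({0..1} \<inter> g -` T) \<longleftrightarrow> openin (top_of_set (g ` {0..1})) T"
    if "T \<subseteq> g ` {0..1}" for T
    using assms that unfolding path_def
    by (intro Abstract_Topology_2.continuous_imp_quotient_map) auto
qed

lemma ex_path_image_Un:
  fixes p q :: "real \<Rightarrow> 'a::real_normed_vector"
  assumes p: "path p" and q: "path q" and ne: "path_image p \<inter> path_image q \<noteq> {}"
  shows "\<exists>g. path g \<and> path_image g = path_image p \<union> path_image q"
proof -
  obtain s t where st: "s \<in> {0..1}" "t \<in> {0..1}" "p s = q t"
    using ne by (force simp: path_image_def)
  \<comment> \<open>Traverse p, run back along it to the common point, continue along q back to its
    start, then traverse q.\<close>
  let ?g = "(p +++ subpath 1 s p) +++ (subpath t 0 q +++ q)"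
  have ends: "pathfinish p = pathstart (subpath 1 s p)"
    "pathfinish (subpath 1 s p) = pathstart (subpath t 0 q)"
    "pathfinish (subpath t 0 q) = pathstart q"
    using st by (simp_all add: pathstart_def pathfinish_def subpath_def)
  have sub: "path_image (subpath 1 s p) \<subseteq> path_image p" "path_image (subpath t 0 q) \<subseteq> path_image q"
    using st path_image_subpath_subset[of 1 s p] path_image_subpath_subset[of t 0 q] by auto
  have "path ?g"
    using p q st ends by (intro path_join_imp path_subpath) (simp_all)
  moreover have "path_image ?g = path_image p \<union> path_image q"
    using sub ends by (subst path_image_join; simp add: path_image_join) blast
  ultimately show ?thesis by blast
qed

text \<open>This is the lifting criterion for the covering \<open>exp\<close> of the punctured
  plane: a lift exists unless some loop has an image whose lift does not close up. Nonzero winding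
  is expressed without winding numbers: no continuous argument along r returns to its initial
  value.\<close>

lemma ex_log_or_loop:
  fixes K :: "'a::euclidean_space set"
  assumes K: "path_connected K" "locally path_connected K"
    and f: "continuous_on K f" "f ` K \<subseteq> sphere 0 1"
  obtains (log) \<theta> :: "'a \<Rightarrow> real" where "continuous_on K \<theta>" "\<And>z. z \<in> K \<Longrightarrow> f z = cis (\<theta> z)"
    | (loop) r where "path r" "path_image r \<subseteq> K" "pathfinish r = pathstart r"
       "\<And>\<tau> :: real \<Rightarrow> real. continuous_on {0..1} \<tau> \<Longrightarrow> (\<And>t. t \<in> {0..1} \<Longrightarrow> f (r t) = cis (\<tau> t)) \<Longrightarrow> \<tau> 1 \<noteq> \<tau> 0"
proof (cases "K = {}")
  case True
  then show ?thesis using log[of "\<lambda>_. 0"] by simp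
next
  case False
  then obtain z where z: "z \<in> K" by blast
  have f1: "norm (f w) = 1" if "w \<in> K" for w
    using f(2) that by auto
  have fS: "f \<in> K \<rightarrow> - {0}" using f1 by force
  obtain a where a: "f z = exp a"
    using f1[OF z] by (metis exp_Ln norm_zero zero_neq_one)
  show ?thesis
  proof (cases "\<exists>r. path r \<and> path_image r \<subseteq> K \<and> pathstart r = z \<and> pathfinish r = z \<and>
       (\<forall>\<tau> :: real \<Rightarrow> real. continuous_on {0..1} \<tau> \<longrightarrow> (\<forall>t\<in>{0..1}. f (r t) = cis (\<tau> t)) \<longrightarrow> \<tau> 1 \<noteq> \<tau> 0)")
    case True
    then show ?thesis using loop by metis
  next
    case False
    have "\<exists>q. path q \<and> path_image q \<subseteq> UNIV \<and> pathstart q = a \<and> pathfinish q = a \<and>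
           homotopic_paths (- {0}) (f \<circ> r) (exp \<circ> q)"
      if r: "path r" "path_image r \<subseteq> K" "pathstart r = z" "pathfinish r = z" for r
    proof -
      obtain \<tau> :: "real \<Rightarrow> real" where \<tau>: "continuous_on {0..1} \<tau>" "\<And>t. t \<in> {0..1} \<Longrightarrow> f (r t) = cis (\<tau> t)"
          "\<tau> 1 = \<tau> 0"
        using False r by metis
      \<comment> \<open>The argument \<tau> is shifted to a lift that starts and ends at a, the
        chosen logarithm of \<open>f z\<close> at the base point.\<close>
      define q where "q t = \<i> * of_real (\<tau> t - \<tau> 0) + a" for t
      have "path q" unfolding path_def q_def by (intro continuous_intros \<tau>)
      moreover have eq: "exp (q t) = f (r t)" if "t \<in> {0..1}" for t
      proof -
        have "exp a = cis (\<tau> 0)" using \<tau>(2)[of 0] r(3) a by (simp add: pathstart_def)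
        then show ?thesis
          using \<tau>(2)[OF that] unfolding q_def exp_add cis_conv_exp[symmetric] by (simp add: cis_mult)
      qed
      moreover have "homotopic_paths (- {0}) (f \<circ> r) (exp \<circ> q)"
      proof (rule homotopic_paths_eq)
        show "path (f \<circ> r)" using r f(1) by (auto intro!: path_continuous_image intro: continuous_on_subset)
        show "path_image (f \<circ> r) \<subseteq> - {0}" using r fS by (auto simp: path_image_compose)
      qed (use eq in auto)
      ultimately show ?thesis
        using \<tau>(3) by (intro exI[of _ q]) (simp add: q_def pathstart_def pathfinish_def)
    qed
    then obtain g where g: "continuous_on K g" "\<And>y. y \<in> K \<Longrightarrow> exp (g y) = f y"
      using covering_space_lift_general[OF covering_space_exp_punctured_plane _ z K f(1) fS, of a] a
      by (metis UNIV_I)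
    show ?thesis
    proof (rule log[of "\<lambda>y. Im (g y)"])
      show "continuous_on K (\<lambda>y. Im (g y))" by (intro continuous_intros g)
      fix y assume y: "y \<in> K"
      have "exp (Re (g y)) = 1" using g(2)[OF y] f1[OF y] by (metis norm_exp_eq_Re)
      then have "g y = \<i> * of_real (Im (g y))" by (simp add: complex_eq_iff)
      then show "f y = cis (Im (g y))" using g(2)[OF y] by (metis cis_conv_exp)
    qed
  qed
qed

section \<open>Angles, lifts and loops on the circle and the torus\<close>

lemma cis_eq_cis_iff: "cis x = cis y \<longleftrightarrow> (\<exists>k::int. x = y + 2 * pi * k)"
proof -
  have "cis x = cis y \<longleftrightarrow> cis (x - y) = 1"
    by (auto simp: cis_divide[symmetric])
  also have "\<dots> \<longleftrightarrow> (\<exists>k::int. x - y = 2 * pi * k)"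
    by (auto simp: cis_conv_exp exp_eq_1 mult.commute)
  finally show ?thesis by (auto simp: algebra_simps)
qed

lemma cis_lift_path:
  assumes g: "path g" "path_image g \<subseteq> sphere 0 1"
  obtains \<alpha> :: "real \<Rightarrow> real" where "continuous_on {0..1} \<alpha>" "\<And>t. t \<in> {0..1} \<Longrightarrow> g t = cis (\<alpha> t)"
proof -
  have "path_image g \<subseteq> - {0}" using g(2) by auto
  then obtain h where h: "path h" "\<And>t. t \<in> {0..1} \<Longrightarrow> exp (h t) = g t"
    using covering_space_lift_path[OF covering_space_exp_punctured_plane g(1)] by metis
  show ?thesis
  proof
    show "continuous_on {0..1} (\<lambda>t. Im (h t))"
      using h(1) unfolding path_def by (intro continuous_intros)
    fix t :: real assume t: "t \<in> {0..1}"
    then have "g t \<in> sphere 0 1" using g(2) unfolding path_image_def by blast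
    then have "norm (g t) = 1" by simp
    then have "exp (Re (h t)) = 1" using h(2)[OF t] by (metis norm_exp_eq_Re)
    then have "h t = \<i> * of_real (Im (h t))" by (simp add: complex_eq_iff)
    then show "g t = cis (Im (h t))" using h(2)[OF t] by (metis cis_conv_exp)
  qed
qed

text \<open>The periodic extension factors through the circle. Continuity of the map that the loop g
  induces on the circle is read off from the trivial homotopy of g to itself.\<close>

lemma continuous_on_frac_loop:
  fixes g :: "real \<Rightarrow> 'a::real_normed_vector"
  assumes "path g" "pathfinish g = pathstart g"
  shows "continuous_on UNIV (\<lambda>x. g (frac x))"
proof -
  have "homotopic_loops (path_image g) g g"
    using assms by (simp add: homotopic_loops_refl)
  from homotopic_loops_imp_homotopic_circlemaps[OF this]
  have "continuous_on (sphere 0 1) (g \<circ> (\<lambda>z. Arg2pi z / (2 * pi)))"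
    by (rule homotopic_with_imp_continuous[THEN conjunct1])
  then have "continuous_on UNIV ((g \<circ> (\<lambda>z. Arg2pi z / (2 * pi))) \<circ> (\<lambda>x. cis (2 * pi * x)))"
    unfolding o_def
    by (rule continuous_on_compose2[where f = "\<lambda>x. cis (2 * pi * x)"]) (auto intro!: continuous_intros)
  moreover have "Arg2pi (cis (2 * pi * x)) / (2 * pi) = frac x" for x
  proof -
    let ?u = "Arg2pi (cis (2 * pi * x)) / (2 * pi)"
    have u: "0 \<le> ?u" "?u < 1"
      using Arg2pi_ge_0 Arg2pi_lt_2pi by (auto simp: field_simps)
    have "cis (2 * pi * ?u) = cis (2 * pi * x)"
      using Arg2pi_eq[of "cis (2 * pi * x)"] by (simp add: cis_conv_exp)
    then obtain k :: int where "2 * pi * ?u = 2 * pi * x + 2 * pi * k"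
      unfolding cis_eq_cis_iff by blast
    then have "2 * pi * ?u = 2 * pi * (x + k)" by (simp only: distrib_left)
    then have "?u = x + k" by simp
    then have "x - ?u \<in> \<int>" by simp
    then show ?thesis using u by (metis frac_unique_iff)
  qed
  ultimately show ?thesis by (simp add: o_def)
qed

text \<open>\<open>K\<close> contains a loop of homotopy class \<open>(p, q)\<close> in the torus.\<close>

definition torus_loop :: "(complex \<times> complex) set \<Rightarrow> int \<Rightarrow> int \<Rightarrow> bool" where
  "torus_loop K p q \<longleftrightarrow> (\<exists>\<alpha> \<beta>. continuous_on {0..1} \<alpha> \<and> continuous_on {0..1} \<beta> \<and>
     (\<forall>t\<in>{0..1::real}. (cis (\<alpha> t), cis (\<beta> t)) \<in> K) \<and>
     \<alpha> 1 = \<alpha> 0 + 2 * pi * p \<and> \<beta> 1 = \<beta> 0 + 2 * pi * q)"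

text \<open>Subtracting the linear part from a lift leaves a correction with equal values at 0 and
  1, which therefore extends periodically and is bounded. Angles are measured in full turns
  here.\<close>

lemma torus_loop_periodic:
  assumes "torus_loop K p q"
  obtains g h :: "real \<Rightarrow> real" where "continuous_on UNIV g" "continuous_on UNIV h" "bounded (range g)" "bounded (range h)"
    "\<And>x::real. (cis (2 * pi * (p * x + g x)), cis (2 * pi * (q * x + h x))) \<in> K"
proof -
  obtain \<alpha> \<beta> :: "real \<Rightarrow> real" where \<alpha>: "continuous_on {0..1} \<alpha>" "\<alpha> 1 = \<alpha> 0 + 2 * pi * p"
    and \<beta>: "continuous_on {0..1} \<beta>" "\<beta> 1 = \<beta> 0 + 2 * pi * q"
    and K: "\<And>t. t \<in> {0..1} \<Longrightarrow> (cis (\<alpha> t), cis (\<beta> t)) \<in> K"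
    using assms unfolding torus_loop_def by blast
  define lin where "lin m \<phi> t = \<phi> t / (2 * pi) - real_of_int m * t" for m and \<phi> :: "real \<Rightarrow> real" and t
  have frac01: "frac x \<in> {0..1}" for x :: real using frac_lt_1[of x] by (simp add: less_imp_le)
  have cont: "continuous_on UNIV (\<lambda>x. lin m \<phi> (frac x))" and bdd: "bounded (range (\<lambda>x. lin m \<phi> (frac x)))"
    and eq: "cis (2 * pi * (m * x + lin m \<phi> (frac x))) = cis (\<phi> (frac x))"
    if "continuous_on {0..1} \<phi>" "\<phi> 1 = \<phi> 0 + 2 * pi * m" for m \<phi> x
  proof -
    have c: "continuous_on {0..1} (lin m \<phi>)"
      unfolding lin_def by (intro continuous_intros that) simp
    have "lin m \<phi> 1 = lin m \<phi> 0" using that(2) by (simp add: lin_def field_simps)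
    then show "continuous_on UNIV (\<lambda>x. lin m \<phi> (frac x))"
      using c by (intro continuous_on_frac_loop) (simp_all add: path_def pathstart_def pathfinish_def)
    have "bounded (lin m \<phi> ` {0..1})"
      using c by (intro compact_imp_bounded compact_continuous_image) auto
    then show "bounded (range (\<lambda>x. lin m \<phi> (frac x)))"
      by (rule bounded_subset) (use frac01 in blast)
    have "2 * pi * (m * x + lin m \<phi> (frac x)) = \<phi> (frac x) + 2 * pi * real_of_int (m * \<lfloor>x\<rfloor>)"
      by (simp add: lin_def frac_def field_simps)
    then show "cis (2 * pi * (m * x + lin m \<phi> (frac x))) = cis (\<phi> (frac x))"
      unfolding cis_eq_cis_iff by blast
  qed
  show ?thesis
    by (rule that[of "\<lambda>x. lin p \<alpha> (frac x)" "\<lambda>x. lin q \<beta> (frac x)"])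
      (use cont[OF \<alpha>] cont[OF \<beta>] bdd[OF \<alpha>] bdd[OF \<beta>] eq[OF \<alpha>] eq[OF \<beta>] K frac01 in auto)
qed

text \<open>Lifted to the plane, the loops stay at bounded distance from two lines of different
  slope, so they ought to cross. The parameters of a crossing solve two equations with an invertible
  linear part and bounded remainder. Inverting the linear part gives a fixed point problem for a
  bounded continuous map, which Brouwer's theorem solves on a large ball.\<close>

lemma torus_loops_Int_nonempty:
  assumes 1: "torus_loop K p q" and 2: "torus_loop K' p' q'" and det: "p * q' - q * p' \<noteq> 0"
  shows "K \<inter> K' \<noteq> {}"
proof -
  obtain g h :: "real \<Rightarrow> real" where gh: "continuous_on UNIV g" "continuous_on UNIV h" "bounded (range g)" "bounded (range h)"
    "\<And>x::real. (cis (2 * pi * (p * x + g x)), cis (2 * pi * (q * x + h x))) \<in> K"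
    by (rule torus_loop_periodic[OF 1]) (rule that)
  obtain g' h' :: "real \<Rightarrow> real" where gh': "continuous_on UNIV g'" "continuous_on UNIV h'" "bounded (range g')" "bounded (range h')"
    "\<And>x::real. (cis (2 * pi * (p' * x + g' x)), cis (2 * pi * (q' * x + h' x))) \<in> K'"
    by (rule torus_loop_periodic[OF 2]) (rule that)
  define D where "D = real_of_int (p * q' - q * p')"
  have D: "D \<noteq> 0" using det unfolding D_def of_int_eq_0_iff .
  define u where "u z = g' (snd z) - g (fst z)" for z :: "real \<times> real"
  define v where "v z = h' (snd z) - h (fst z)" for z :: "real \<times> real"
  \<comment> \<open>Cramer's rule: a fixed point \<open>(x, y)\<close> of \<open>F\<close> satisfies \<open>p x - p' y = u\<close> and \<open>q x - q' y = v\<close>.\<close>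
  define F where "F z = ((q' * u z - p' * v z) / D, (q * u z - p * v z) / D)" for z
  have cont: "continuous_on UNIV F"
    unfolding F_def u_def v_def using D
    by (intro continuous_intros continuous_on_compose2[OF gh(1)] continuous_on_compose2[OF gh(2)]
        continuous_on_compose2[OF gh'(1)] continuous_on_compose2[OF gh'(2)]) auto
  have "bounded (range (\<lambda>z. g' (snd z)))" "bounded (range (\<lambda>z. g (fst z)))"
    "bounded (range (\<lambda>z. h' (snd z)))" "bounded (range (\<lambda>z. h (fst z)))"
    by (rule bounded_subset[OF gh'(3)] bounded_subset[OF gh(3)] bounded_subset[OF gh'(4)]
        bounded_subset[OF gh(4)]; blast)+
  then have "bounded (range u)" "bounded (range v)"
    unfolding u_def v_def by (auto intro: bounded_minus_comp)
  then have "bounded (range (\<lambda>z. (c / D) *\<^sub>R u z - (d / D) *\<^sub>R v z))" for c d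
    using bounded_scaling[of "range u" "c / D"] bounded_scaling[of "range v" "d / D"]
    by (intro bounded_minus_comp) (simp_all only: image_image)
  from bounded_Times[OF this[of q' p'] this[of q p]] have "bounded (range F)"
    by (rule bounded_subset) (auto simp: F_def diff_divide_distrib)
  then obtain B where B: "\<And>z. norm (F z) \<le> B" unfolding bounded_iff by blast
  have "0 \<le> B" using B[of 0] norm_ge_zero order_trans by blast
  obtain z where z: "F z = z"
  proof (rule brouwer[of "cball 0 B" F])
    show "continuous_on (cball 0 B) F" using cont by (rule continuous_on_subset) simp
    show "F \<in> cball 0 B \<rightarrow> cball 0 B" using B by simp
  qed (use \<open>0 \<le> B\<close> in auto)
  obtain x y where xy: "z = (x, y)" by (cases z)
  have x: "x * D = q' * u z - p' * v z" and y: "y * D = q * u z - p * v z"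
    using z D unfolding F_def xy by (auto simp: field_simps)
  have "(p * x - p' * y) * D = u z * D" "(q * x - q' * y) * D = v z * D"
  proof -
    have "(p * x - p' * y) * D = p * (x * D) - p' * (y * D)" by (simp add: algebra_simps)
    also have "\<dots> = u z * D" unfolding x y by (simp add: D_def algebra_simps)
    finally show "(p * x - p' * y) * D = u z * D" .
    have "(q * x - q' * y) * D = q * (x * D) - q' * (y * D)" by (simp add: algebra_simps)
    also have "\<dots> = v z * D" unfolding x y by (simp add: D_def algebra_simps)
    finally show "(q * x - q' * y) * D = v z * D" .
  qed
  then have "p * x - p' * y = u z" "q * x - q' * y = v z" using D by simp_all
  then have "p * x + g x = p' * y + g' y" "q * x + h x = q' * y + h' y"
    unfolding u_def v_def xy by simp_all
  then have "(cis (2 * pi * (p * x + g x)), cis (2 * pi * (q * x + h x))) \<in> K'"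
    using gh'(5)[of y] by simp
  then show ?thesis using gh(5)[of x] by blast
qed

text \<open>Injectivity and continuity are what \<open>K33_config_image\<close> asks for; on the
  compact sets to which this is applied, such a map is a homeomorphism onto its image.\<close>

definition planar_embeddable :: "'a::topological_space set \<Rightarrow> bool" where
  "planar_embeddable K \<longleftrightarrow> (\<exists>h :: 'a \<Rightarrow> complex. continuous_on K h \<and> inj_on h K)"

text \<open>
  After a unimodular change of coordinates of the torus, the first coordinate is \<open>cis \<theta>\<close> on \<open>K\<close>; the
  embedding uses \<open>exp \<theta>\<close> as modulus and the second coordinate as argument.
\<close>

lemma planar_embeddable_if_log:
  fixes K :: "(complex \<times> complex) set"
  assumes K: "K \<subseteq> sphere 0 1 \<times> sphere 0 1" and ab: "coprime a b"
    and \<theta>: "continuous_on K \<theta>" "\<And>z. z \<in> K \<Longrightarrow> fst z powi a * snd z powi b = cis (\<theta> z)"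
  shows "planar_embeddable K"
proof -
  obtain u v where uv: "u * a + v * b = 1"
    using ab bezout_int[of a b] by auto
  have nz: "fst z \<noteq> 0" "snd z \<noteq> 0" "norm (fst z) = 1" "norm (snd z) = 1" if "z \<in> K" for z
    using subsetD[OF K that] by (cases z; auto)+
  \<comment> \<open>The rows (a, b) and (-v, u) form an integer matrix of determinant 1, so the two
    corresponding monomials are coordinates of the torus. The modulus records \<theta> itself, from
    which the first monomial follows.\<close>
  define h where "h z = of_real (exp (\<theta> z)) * (fst z powi (- v) * snd z powi u)" for z :: "complex \<times> complex"
  have "continuous_on K h"
    unfolding h_def using nz by (intro continuous_intros \<theta>) auto
  moreover have "inj_on h K"
  proof (rule inj_onI)
    fix z w assume zw: "z \<in> K" "w \<in> K" "h z = h w"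
    have "norm (h z) = exp (\<theta> z)" if "z \<in> K" for z
      using nz[OF that] by (simp add: h_def norm_mult norm_power_int)
    then have "\<theta> z = \<theta> w" using zw by (metis exp_inj_iff)
    then have 1: "fst z powi a * snd z powi b = fst w powi a * snd w powi b"
      and 2: "fst z powi (- v) * snd z powi u = fst w powi (- v) * snd w powi u"
      using \<theta>(2) zw by (auto simp: h_def)
    \<comment> \<open>The inverse of that integer matrix recovers the point from the two
      monomials.\<close>
    have fst: "fst z = (fst z powi a * snd z powi b) powi u * (fst z powi (- v) * snd z powi u) powi (- b)"
      and snd: "snd z = (fst z powi a * snd z powi b) powi v * (fst z powi (- v) * snd z powi u) powi a"
      if "z \<in> K" for z
    proof -
      have *: "(x powi a * y powi b) powi m * (x powi (- v) * y powi u) powi k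
          = x powi (a * m - v * k) * y powi (b * m + u * k)"
        if "x \<noteq> 0" "y \<noteq> 0" for x y :: complex and m k
      proof -
        have "(x powi a * y powi b) powi m * (x powi (- v) * y powi u) powi k
          = (x powi (a * m) * x powi (- v * k)) * (y powi (b * m) * y powi (u * k))"
          by (simp only: power_int_mult_distrib power_int_mult) (simp only: ac_simps)
        then show ?thesis
          using that by (simp add: power_int_add[symmetric])
      qed
      have "a * u - v * (- b) = 1" "b * u + u * (- b) = 0" "a * v - v * a = 0" "b * v + u * a = 1"
        using uv by (simp_all add: algebra_simps)
      then show "fst z = (fst z powi a * snd z powi b) powi u * (fst z powi (- v) * snd z powi u) powi (- b)"
        and "snd z = (fst z powi a * snd z powi b) powi v * (fst z powi (- v) * snd z powi u) powi a"
        unfolding *[OF nz(1,2)[OF that]] by simp_all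
    qed
    show "z = w"
      using trans[OF fst[OF zw(1), unfolded 1 2] fst[OF zw(2), symmetric]]
        trans[OF snd[OF zw(1), unfolded 1 2] snd[OF zw(2), symmetric]] by (rule prod_eqI)
  qed
  ultimately show ?thesis unfolding planar_embeddable_def by blast
qed

text \<open>A continuous argument of the character \<open>fst z powi a * snd z powi b\<close> on K
  would embed K into the plane. So this character winds nontrivially along some loop of K, and its
  winding number along a loop of class (p, q) is a p + b q.\<close>

lemma ex_torus_loop:
  assumes K: "K \<subseteq> sphere 0 1 \<times> sphere 0 1" "path_connected K" "locally path_connected K"
    and np: "\<not> planar_embeddable K" and ab: "coprime a b"
  obtains p q where "torus_loop K p q" "a * p + b * q \<noteq> 0"
proof -
  define f where "f z = fst z powi a * snd z powi b" for z :: "complex \<times> complex"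
  have nz: "fst z \<noteq> 0" "snd z \<noteq> 0" "norm (fst z) = 1" "norm (snd z) = 1" if "z \<in> K" for z
    using subsetD[OF K(1) that] by (cases z; auto)+
  have f: "continuous_on K f" "f ` K \<subseteq> sphere 0 1"
    unfolding f_def using nz by (auto intro!: continuous_intros simp: norm_mult norm_power_int)
  show ?thesis
    using K(2,3) f
  proof (cases rule: ex_log_or_loop)
    case (log \<theta>)
    then show ?thesis using planar_embeddable_if_log[OF K(1) ab] np by (auto simp: f_def)
  next
    case (loop r)
    have "path (fst \<circ> r)" "path (snd \<circ> r)"
      using loop(1) unfolding path_def o_def by (auto intro!: continuous_intros)
    moreover have "path_image (fst \<circ> r) \<subseteq> sphere 0 1" "path_image (snd \<circ> r) \<subseteq> sphere 0 1"
      using loop(2) K(1) by (auto simp: path_image_compose)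
    ultimately obtain \<alpha> \<beta> :: "real \<Rightarrow> real" where
      \<alpha>: "continuous_on {0..1} \<alpha>" "\<And>t. t \<in> {0..1} \<Longrightarrow> fst (r t) = cis (\<alpha> t)" and
      \<beta>: "continuous_on {0..1} \<beta>" "\<And>t. t \<in> {0..1} \<Longrightarrow> snd (r t) = cis (\<beta> t)"
      by (metis cis_lift_path comp_apply)
    have r01: "r 1 = r 0" using loop(3) by (simp add: pathstart_def pathfinish_def)
    obtain p :: int where p: "\<alpha> 1 = \<alpha> 0 + 2 * pi * p"
      using \<alpha>(2)[of 0] \<alpha>(2)[of 1] r01 cis_eq_cis_iff[of "\<alpha> 1" "\<alpha> 0"] by auto
    obtain q :: int where q: "\<beta> 1 = \<beta> 0 + 2 * pi * q"
      using \<beta>(2)[of 0] \<beta>(2)[of 1] r01 cis_eq_cis_iff[of "\<beta> 1" "\<beta> 0"] by auto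
    have "torus_loop K p q"
      unfolding torus_loop_def
    proof (rule exI[of _ \<alpha>], rule exI[of _ \<beta>], intro conjI ballI)
      fix t :: real assume t: "t \<in> {0..1}"
      then have "r t \<in> K" using loop(2) by (auto simp: path_image_def)
      then show "(cis (\<alpha> t), cis (\<beta> t)) \<in> K" using \<alpha>(2) \<beta>(2) t by (metis prod.collapse)
    qed (use \<alpha> \<beta> p q in auto)
    moreover have "continuous_on {0..1} (\<lambda>t. a * \<alpha> t + b * \<beta> t)" by (intro continuous_intros \<alpha> \<beta>)
    moreover have "f (r t) = cis (a * \<alpha> t + b * \<beta> t)" if "t \<in> {0..1}" for t
      using \<alpha>(2)[OF that] \<beta>(2)[OF that] by (simp add: f_def cis_power_int cis_mult mult.commute)
    ultimately have "torus_loop K p q" "a * \<alpha> 1 + b * \<beta> 1 \<noteq> a * \<alpha> 0 + b * \<beta> 0"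
      using loop(4)[of "\<lambda>t. a * \<alpha> t + b * \<beta> t"] by blast+
    moreover from this(2) have "a * p + b * q \<noteq> 0"
    proof (rule contrapos_nn)
      assume "a * p + b * q = 0"
      then have "real_of_int a * p + b * q = 0" by (metis of_int_0 of_int_add of_int_mult)
      then have "2 * pi * (real_of_int a * p + b * q) = 0" by simp
      then show "a * \<alpha> 1 + b * \<beta> 1 = a * \<alpha> 0 + b * \<beta> 0" unfolding p q by (simp add: algebra_simps)
    qed
    ultimately show ?thesis using that by blast
  qed
qed

text \<open>Loops in \<open>K\<close> and \<open>K'\<close> with linearly independent homotopy classes would meet.\<close>

theorem planar_embeddable_if_disjoint_in_torus:
  fixes K K' :: "(complex \<times> complex) set"
  assumes K: "K \<subseteq> sphere 0 1 \<times> sphere 0 1" "path_connected K" "locally path_connected K"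
    and K': "K' \<subseteq> sphere 0 1 \<times> sphere 0 1" "path_connected K'" "locally path_connected K'"
    and dis: "K \<inter> K' = {}"
  shows "planar_embeddable K \<or> planar_embeddable K'"
proof (rule ccontr)
  assume "\<not> ?thesis"
  then have np: "\<not> planar_embeddable K" "\<not> planar_embeddable K'" by auto
  obtain p q where pq: "torus_loop K p q" "p \<noteq> 0"
    using ex_torus_loop[OF K np(1), of 1 0] by auto
  \<comment> \<open>The character with exponents -q/g and p/g does not wind along loops of class (p,
    q), so a loop of \<open>K'\<close> along which it winds has an independent class. Division by
    the gcd provides the coprimality that \<open>ex_torus_loop\<close> asks for.\<close>
  define g where "g = gcd p q"
  have g: "g \<noteq> 0" "p = g * (p div g)" "q = g * (q div g)" using pq(2) by (auto simp: g_def)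
  have "coprime (- (q div g)) (p div g)"
    using pq(2) by (simp add: g_def div_gcd_coprime coprime_commute)
  then obtain p' q' where pq': "torus_loop K' p' q'" "- (q div g) * p' + (p div g) * q' \<noteq> 0"
    using ex_torus_loop[OF K' np(2)] by blast
  have "p * q' - q * p' = g * (- (q div g) * p' + (p div g) * q')"
    by (subst g(2), subst g(3)) (simp add: algebra_simps)
  then have "p * q' - q * p' \<noteq> 0" using pq'(2) g(1) by simp
  then show False using torus_loops_Int_nonempty[OF pq(1) pq'(1)] dis by blast
qed

section \<open>The 5-cube is not toroidal\<close>

lemma not_planar_embeddable_if_K33_config:
  "K33_config K \<Longrightarrow> \<not> planar_embeddable K"
  using K33_config_image not_K33_config_complex unfolding planar_embeddable_def by blast

fun walk_edges :: "'a list \<Rightarrow> 'a set set" where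
  "walk_edges (u # v # vs) = insert {u, v} (walk_edges (v # vs))"
| "walk_edges _ = {}"

lemma Union_walk_edges: "length vs \<ge> 2 \<Longrightarrow> \<Union> (walk_edges vs) = set vs"
  by (induction vs rule: walk_edges.induct) (case_tac vs; auto)+

lemma walk_edges_card: "distinct vs \<Longrightarrow> e \<in> walk_edges vs \<Longrightarrow> card e = 2"
  by (induction vs rule: walk_edges.induct) auto

locale surface_drawing =
  fixes S :: "'p::real_normed_vector set" and G :: "('a, 'b) pre_digraph" and \<phi> \<gamma>
  assumes drawing: "drawing_in S G \<phi> \<gamma>"
begin

definition edge_points :: "'a set set \<Rightarrow> 'p set" where
  "edge_points E = (\<Union>e\<in>E. path_image (\<gamma> e))"

lemma edge_points_subset: "E \<subseteq> undirected_edges G \<Longrightarrow> edge_points E \<subseteq> S"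
  using drawing by (auto simp: edge_points_def drawing_in_def)

text \<open>Every later claim on intersections of point sets is reduced by this to a computation
  with finite sets of vertices.\<close>

lemma edge_points_Int:
  assumes "E \<subseteq> undirected_edges G" "F \<subseteq> undirected_edges G" "E \<inter> F = {}"
  shows "edge_points E \<inter> edge_points F = \<phi> ` (\<Union> E \<inter> \<Union> F)"
proof -
  have "\<forall>e\<in>undirected_edges G. \<forall>f\<in>undirected_edges G. e \<noteq> f \<longrightarrow>
      path_image (\<gamma> e) \<inter> path_image (\<gamma> f) = \<phi> ` (e \<inter> f)"
    using drawing by (simp add: drawing_in_def)
  moreover have "e \<in> undirected_edges G" "f \<in> undirected_edges G" "e \<noteq> f" if "e \<in> E" "f \<in> F" for e f
    using that assms by blast+
  ultimately have *: "path_image (\<gamma> e) \<inter> path_image (\<gamma> f) = \<phi> ` (e \<inter> f)" if "e \<in> E" "f \<in> F" for e f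
    using that by simp
  have "edge_points E \<inter> edge_points F = (\<Union>e\<in>E. \<Union>f\<in>F. path_image (\<gamma> e) \<inter> path_image (\<gamma> f))"
    by (auto simp: edge_points_def)
  also have "\<dots> = (\<Union>e\<in>E. \<Union>f\<in>F. \<phi> ` (e \<inter> f))"
    using * by simp
  also have "\<dots> = \<phi> ` (\<Union> E \<inter> \<Union> F)" by auto
  finally show ?thesis .
qed

lemma edge_arc:
  assumes "{u, v} \<in> undirected_edges G"
  shows "\<exists>g. arc g \<and> pathstart g = \<phi> u \<and> pathfinish g = \<phi> v \<and> path_image g = edge_points {{u, v}}"
proof -
  let ?g = "\<gamma> {u, v}"
  have g: "arc ?g" "{pathstart ?g, pathfinish ?g} = {\<phi> u, \<phi> v}"
    using drawing assms by (auto simp: drawing_in_def)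
  then consider "pathstart ?g = \<phi> u" "pathfinish ?g = \<phi> v" | "pathstart ?g = \<phi> v" "pathfinish ?g = \<phi> u"
    by (auto simp: doubleton_eq_iff)
  then show ?thesis
    using g(1) by cases (auto simp: edge_points_def arc_reversepath
        intro: exI[of _ ?g] exI[of _ "reversepath ?g"])
qed

lemma walk_arc:
  assumes "distinct vs" "length vs \<ge> 2" "walk_edges vs \<subseteq> undirected_edges G"
  shows "\<exists>g. arc g \<and> pathstart g = \<phi> (hd vs) \<and> pathfinish g = \<phi> (last vs) \<and>
    path_image g = edge_points (walk_edges vs)"
  using assms
proof (induction vs rule: walk_edges.induct)
  case (1 u v vs)
  obtain g where g: "arc g" "pathstart g = \<phi> u" "pathfinish g = \<phi> v" "path_image g = edge_points {{u, v}}"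
    using edge_arc[of u v] 1 by auto
  show ?case
  proof (cases "vs = []")
    case True
    then show ?thesis using g by auto
  next
    case False
    then have len: "length (v # vs) \<ge> 2" by (cases vs) auto
    then obtain h where h: "arc h" "pathstart h = \<phi> v" "pathfinish h = \<phi> (last (v # vs))"
      "path_image h = edge_points (walk_edges (v # vs))"
      using 1 by auto
    have U: "\<Union> (walk_edges (v # vs)) = set (v # vs)" by (rule Union_walk_edges[OF len])
    then have "{u, v} \<notin> walk_edges (v # vs)" using "1.prems"(1) by auto
    then have "path_image g \<inter> path_image h = \<phi> ` (\<Union> {{u, v}} \<inter> set (v # vs))"
      unfolding g h U[symmetric] using "1.prems"(3) by (intro edge_points_Int) auto
    also have "\<Union> {{u, v}} \<inter> set (v # vs) = {v}" using "1.prems"(1) by auto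
    finally have int: "path_image g \<inter> path_image h \<subseteq> {pathstart h}" using h by simp
    have "arc (g +++ h)" using arc_join[OF g(1) h(1) _ int] g h by simp
    moreover have "path_image (g +++ h) = edge_points (walk_edges (u # v # vs))"
      using g h by (simp add: path_image_join edge_points_def)
    ultimately show ?thesis using g h by (intro exI[of _ "g +++ h"]) simp
  qed
qed auto

text \<open>One side of the bipartition is a, b, x, the other consists of the ends of the walks
  \<open>Q i\<close>. The second conclusion yields path connectedness and local path connectedness
  at once, as needed for disjoint sets in the torus.\<close>

lemma K33_subdivision:
  fixes P Q :: "nat \<Rightarrow> 'a list"
  assumes P: "\<And>i. i < 3 \<Longrightarrow> distinct (P i) \<and> length (P i) \<ge> 2 \<and> walk_edges (P i) \<subseteq> undirected_edges G \<and>
      set (P i) \<subseteq> verts G \<and> hd (P i) = a \<and> last (P i) = b \<and>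
      {a, b} \<notin> walk_edges (P i)"
    and Q: "\<And>i. i < 3 \<Longrightarrow> distinct (Q i) \<and> length (Q i) \<ge> 2 \<and> walk_edges (Q i) \<subseteq> undirected_edges G \<and>
      hd (Q i) = x \<and> last (Q i) \<in> set (P i) - {a, b}"
    and PP: "\<And>i j. i < 3 \<Longrightarrow> j < 3 \<Longrightarrow> i \<noteq> j \<Longrightarrow>
      set (P i) \<inter> set (P j) = {a, b}"
    and QP: "\<And>i j. i < 3 \<Longrightarrow> j < 3 \<Longrightarrow>
      set (Q i) \<inter> set (P j) \<subseteq> {last (Q i)}"
  defines "E \<equiv> (\<Union>i<3. walk_edges (P i) \<union> walk_edges (Q i))"
  shows "K33_config (edge_points E)" "\<exists>g. path g \<and> path_image g = edge_points E"
proof -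
  have "\<exists>g. arc g \<and> pathstart g = \<phi> (hd (P i)) \<and> pathfinish g = \<phi> (last (P i)) \<and>
      path_image g = edge_points (walk_edges (P i))" if "i < 3" for i
    using P[OF that] by (intro walk_arc) auto
  then obtain c where c: "\<And>i. i < 3 \<Longrightarrow> arc (c i) \<and> pathstart (c i) = \<phi> a \<and> pathfinish (c i) = \<phi> b \<and>
      path_image (c i) = edge_points (walk_edges (P i))"
    using P by metis
  have "\<exists>g. arc g \<and> pathstart g = \<phi> (hd (Q i)) \<and> pathfinish g = \<phi> (last (Q i)) \<and>
      path_image g = edge_points (walk_edges (Q i))" if "i < 3" for i
    using Q[OF that] by (intro walk_arc) auto
  then obtain d where d: "\<And>i. i < 3 \<Longrightarrow> arc (d i) \<and> pathstart (d i) = \<phi> x \<and> pathfinish (d i) = \<phi> (last (Q i)) \<and>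
      path_image (d i) = edge_points (walk_edges (Q i))"
    using Q by metis
  have inj: "inj_on \<phi> (verts G)" using drawing by (simp add: drawing_in_def)
  have QPe: "walk_edges (Q i) \<inter> walk_edges (P j) = {}" if "i < 3" "j < 3" for i j
  proof -
    have False if e: "e \<in> walk_edges (Q i)" "e \<in> walk_edges (P j)" for e
    proof -
      have "e \<subseteq> set (Q i)" "e \<subseteq> set (P j)" "card e = 2"
        using Union_walk_edges[of "Q i"] Union_walk_edges[of "P j"] walk_edges_card e
          Q[OF \<open>i < 3\<close>] P[OF \<open>j < 3\<close>] by blast+
      moreover from this have "e \<subseteq> {last (Q i)}" using \<open>i < 3\<close> \<open>j < 3\<close> QP by blast
      ultimately show False using card_mono[of "{last (Q i)}" e] by simp
    qed
    then show ?thesis by blast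
  qed
  have PPe: "walk_edges (P i) \<inter> walk_edges (P j) = {}" if "i < 3" "j < 3" "i \<noteq> j" for i j
  proof -
    have False if e: "e \<in> walk_edges (P i)" "e \<in> walk_edges (P j)" for e
    proof -
      have "e \<subseteq> set (P i)" "e \<subseteq> set (P j)" "card e = 2"
        using Union_walk_edges[of "P i"] Union_walk_edges[of "P j"] walk_edges_card e
          P[OF \<open>i < 3\<close>] P[OF \<open>j < 3\<close>] by blast+
      moreover from this have "e \<subseteq> {a, b}"
        using PP[OF \<open>i < 3\<close> \<open>j < 3\<close> \<open>i \<noteq> j\<close>] by blast
      ultimately have "e = {a, b}"
        using card_seteq[of "{a, b}" e] card_insert_le_m1[of 2 "{b}" a] by simp
      then show False using P[OF \<open>i < 3\<close>] e by blast
    qed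
    then show ?thesis by blast
  qed
  have cc: "path_image (c i) \<inter> path_image (c j) = {\<phi> a, \<phi> b}" if "i < 3" "j < 3" "i \<noteq> j" for i j
    using edge_points_Int[of "walk_edges (P i)" "walk_edges (P j)"] c that P PPe PP
    by (simp add: Union_walk_edges)
  have dc: "path_image (d i) \<inter> path_image (c j) \<subseteq> {pathfinish (d i)}" if "i < 3" "j < 3" for i j
  proof -
    have "path_image (d i) \<inter> path_image (c j) = \<phi> ` (set (Q i) \<inter> set (P j))"
      using edge_points_Int[of "walk_edges (Q i)" "walk_edges (P j)"] c d that P Q QPe
      by (simp add: Union_walk_edges)
    then show ?thesis using QP[OF that] d[OF that(1)] by auto
  qed
  have m: "\<phi> (last (Q i)) \<in> path_image (c i) \<inter> path_image (d i) \<and> \<phi> (last (Q i)) \<notin> {\<phi> a, \<phi> b}" if i: "i < 3" for i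
  proof -
    have ab: "a \<in> verts G" "b \<in> verts G" using PP[of 0 1] P[of 0] by auto
    have l: "last (Q i) \<in> set (P i)" "last (Q i) \<in> verts G" "last (Q i) \<noteq> a" "last (Q i) \<noteq> b"
      using Q[OF i] P[OF i] by auto
    have "last (Q i) \<in> set (Q i)" using Q[OF i] by (intro last_in_set) auto
    then have "\<phi> (last (Q i)) \<in> \<phi> ` (\<Union> (walk_edges (Q i)) \<inter> \<Union> (walk_edges (P i)))"
      using l Q[OF i] P[OF i] by (simp add: Union_walk_edges)
    also have "\<dots> = path_image (d i) \<inter> path_image (c i)"
      using edge_points_Int[of "walk_edges (Q i)" "walk_edges (P i)"] c d i P Q QPe by simp
    finally show ?thesis using l ab inj_onD[OF inj] by blast
  qed
  have sub: "edge_points (walk_edges (P i)) \<subseteq> edge_points E" "edge_points (walk_edges (Q i)) \<subseteq> edge_points E"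
    if "i < 3" for i
    using that by (auto simp: E_def edge_points_def)
  have "K33_drawing (edge_points E) (\<phi> a) (\<phi> b) (\<phi> x) c d"
    using c d cc dc m sub by unfold_locales auto
  then show "K33_config (edge_points E)" unfolding K33_config_def by blast
  \<comment> \<open>Each \<open>d i\<close> is attached to \<open>c i\<close> at its end, and the
    three resulting paths are joined at the image of a.\<close>
  have "\<exists>g. path g \<and> path_image g = path_image (c i) \<union> path_image (d i)" if "i < 3" for i
    using c[OF that] d[OF that] m[OF that] by (intro ex_path_image_Un) (auto simp only: arc_imp_path)
  then obtain r where r: "\<And>i. i < 3 \<Longrightarrow> path (r i) \<and> path_image (r i) = path_image (c i) \<union> path_image (d i)"
    by metis
  have ra: "\<phi> a \<in> path_image (r i)" if "i < 3" for i
    using r[OF that] c[OF that] pathstart_in_path_image[of "c i"] by auto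
  obtain g where g: "path g" "path_image g = path_image (r 0) \<union> path_image (r 1)"
    using ex_path_image_Un[of "r 0" "r 1"] r ra[of 0] ra[of 1] by auto
  obtain h where h: "path h" "path_image h = path_image g \<union> path_image (r 2)"
    using ex_path_image_Un[of g "r 2"] r g ra[of 0] ra[of 2] by auto
  have "edge_points E = (\<Union>i<3. path_image (r i))"
    using r c d by (auto simp: E_def edge_points_def)
  also have "\<dots> = path_image h"
    using g h by (auto simp: numeral_3_eq_3 numeral_2_eq_2 lessThan_Suc)
  finally show "\<exists>g. path g \<and> path_image g = edge_points E" using h by metis
qed

text \<open>The numbers stand for subsets of {p, q, r, s}: 0 is empty, 1 to 3 are p, q, r, then 4 to
  6 are pq, qr, pr, 7 is pqr, 8 is s, and 9 to 11 are ps, qs, rs. The branch vertices are 0, 7, 8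
  against 1, 2, 3; the other six subdivide edges.\<close>

lemma cube_K33_subdivision:
  fixes f :: "nat \<Rightarrow> 'a"
  assumes inj: "inj_on f {..<12}" and V: "f ` {..<12} \<subseteq> verts G"
    and E: "{f 0, f 1} \<in> undirected_edges G" "{f 0, f 2} \<in> undirected_edges G" "{f 0, f 3} \<in> undirected_edges G"
      "{f 1, f 4} \<in> undirected_edges G" "{f 2, f 5} \<in> undirected_edges G" "{f 3, f 6} \<in> undirected_edges G"
      "{f 4, f 7} \<in> undirected_edges G" "{f 5, f 7} \<in> undirected_edges G" "{f 6, f 7} \<in> undirected_edges G"
      "{f 8, f 9} \<in> undirected_edges G" "{f 8, f 10} \<in> undirected_edges G" "{f 8, f 11} \<in> undirected_edges G"
      "{f 9, f 1} \<in> undirected_edges G" "{f 10, f 2} \<in> undirected_edges G" "{f 11, f 3} \<in> undirected_edges G"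
  shows "\<exists>E \<subseteq> undirected_edges G. \<Union> E \<subseteq> f ` {..<12} \<and> {} \<notin> E \<and> K33_config (edge_points E) \<and>
    (\<exists>g. path g \<and> path_image g = edge_points E)"
proof -
  define P :: "nat \<Rightarrow> nat list" where "P = (\<lambda>i. [[0, 1, 4, 7], [0, 2, 5, 7], [0, 3, 6, 7]] ! i)"
  define Q :: "nat \<Rightarrow> nat list" where "Q = (\<lambda>i. [[8, 9, 1], [8, 10, 2], [8, 11, 3]] ! i)"
  have lt3: "i < 3 \<longleftrightarrow> i = 0 \<or> i = Suc 0 \<or> i = 2" for i :: nat by auto
  define E where "E = (\<Union>i<3. walk_edges (map f (P i)) \<union> walk_edges (map f (Q i)))"
  have PQ12: "set (P i) \<subseteq> {..<12}" "set (Q i) \<subseteq> {..<12}" if "i < 3" for i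
    using that unfolding lt3 by (auto simp: P_def Q_def)
  have inj_eq: "f u = f v \<longleftrightarrow> u = v" if "u < 12" "v < 12" for u v
    using inj_on_eq_iff[OF inj] that by simp
  have Int: "f ` A \<inter> f ` B = f ` (A \<inter> B)" if "A \<subseteq> {..<12}" "B \<subseteq> {..<12}" for A B
    using inj_on_image_Int[OF inj that] by simp
  have P: "distinct (map f (P i)) \<and> length (map f (P i)) \<ge> 2 \<and> walk_edges (map f (P i)) \<subseteq> undirected_edges G \<and>
      set (map f (P i)) \<subseteq> verts G \<and> hd (map f (P i)) = f 0 \<and> last (map f (P i)) = f 7 \<and>
      {f 0, f 7} \<notin> walk_edges (map f (P i))" if i: "i < 3" for i
  proof -
    have "set (map f (P i)) \<subseteq> verts G" using image_mono[OF PQ12(1)[OF i], of f] V by simp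
    then show ?thesis
      using i E unfolding lt3 by (elim disjE) (simp_all add: P_def inj_eq doubleton_eq_iff)
  qed
  have Q: "distinct (map f (Q i)) \<and> length (map f (Q i)) \<ge> 2 \<and> walk_edges (map f (Q i)) \<subseteq> undirected_edges G \<and>
      hd (map f (Q i)) = f 8 \<and> last (map f (Q i)) \<in> set (map f (P i)) - {f 0, f 7}" if "i < 3" for i
    using that E unfolding lt3 by (elim disjE) (simp_all add: P_def Q_def inj_eq)
  have PP: "set (map f (P i)) \<inter> set (map f (P j)) = {f 0, f 7}" if "i < 3" "j < 3" "i \<noteq> j" for i j
  proof -
    have "set (P i) \<inter> set (P j) = {0, 7}"
      using that unfolding lt3 P_def by auto
    then show ?thesis using Int[OF PQ12(1,1)] that by simp
  qed
  have QP: "set (map f (Q i)) \<inter> set (map f (P j)) \<subseteq> {last (map f (Q i))}" if "i < 3" "j < 3" for i j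
  proof -
    have "set (Q i) \<inter> set (P j) \<subseteq> {last (Q i)}" "Q i \<noteq> []"
      using that unfolding lt3 P_def Q_def by auto
    then show ?thesis using Int[OF PQ12(2,1)] that by (auto simp: last_map)
  qed
  have "K33_config (edge_points E)" "\<exists>g. path g \<and> path_image g = edge_points E"
    unfolding E_def by (rule K33_subdivision[OF P Q PP QP]; assumption)+
  moreover have "E \<subseteq> undirected_edges G" unfolding E_def using P Q by blast
  moreover have "\<Union> E \<subseteq> f ` {..<12}"
  proof -
    have "\<Union> (walk_edges (map f (P i))) \<subseteq> f ` {..<12}" "\<Union> (walk_edges (map f (Q i))) \<subseteq> f ` {..<12}"
      if "i < 3" for i
      using P[OF that] Q[OF that] image_mono[OF PQ12(1)[OF that], of f] image_mono[OF PQ12(2)[OF that], of f]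
      by (simp_all add: Union_walk_edges)
    then show ?thesis unfolding E_def by blast
  qed
  moreover have "{} \<notin> E"
  proof
    assume "{} \<in> E"
    then obtain i where i: "i < 3" "{} \<in> walk_edges (map f (P i)) \<or> {} \<in> walk_edges (map f (Q i))"
      unfolding E_def by blast
    moreover have "distinct (map f (P i))" "distinct (map f (Q i))" using P[OF i(1)] Q[OF i(1)] by blast+
    ultimately have "card ({} :: 'a set) = 2" using walk_edges_card by blast
    then show False by simp
  qed
  ultimately show ?thesis by blast
qed

end

lemma disjoint_K33_subdivisions_not_in_torus:
  assumes "surface_drawing torus G \<phi> \<gamma>" and E: "E \<subseteq> undirected_edges G" "E' \<subseteq> undirected_edges G" "\<Union> E \<inter> \<Union> E' = {}"
    "{} \<notin> E"
    and K: "K33_config (surface_drawing.edge_points \<gamma> E)"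
      "\<exists>g. path g \<and> path_image g = surface_drawing.edge_points \<gamma> E"
    and K': "K33_config (surface_drawing.edge_points \<gamma> E')"
      "\<exists>g. path g \<and> path_image g = surface_drawing.edge_points \<gamma> E'"
  shows False
proof -
  interpret surface_drawing torus G \<phi> \<gamma> by fact
  \<comment> \<open>Disjoint unions exclude a common member only if it is nonempty, whence the
    assumption \<open>{} \<notin> E\<close>.\<close>
  have "E \<inter> E' = {}"
  proof (rule ccontr)
    assume "E \<inter> E' \<noteq> {}"
    then obtain e where "e \<in> E" "e \<in> E'" by blast
    moreover from this obtain v where "v \<in> e" using E(4) by (metis all_not_in_conv)
    ultimately show False using E(3) by blast
  qed
  then have dis: "edge_points E \<inter> edge_points E' = {}"
    using edge_points_Int[OF E(1,2)] E(3) by simp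
  have lpc: "path_connected K \<and> locally path_connected K" if "\<exists>g. path g \<and> path_image g = K"
    for K :: "(complex \<times> complex) set"
    using that path_connected_path_image locally_path_connected_path_image by blast
  have "planar_embeddable (edge_points E) \<or> planar_embeddable (edge_points E')"
    using edge_points_subset[OF E(1)] edge_points_subset[OF E(2)] lpc[OF K(2)] lpc[OF K'(2)] dis
    by (intro planar_embeddable_if_disjoint_in_torus) (simp_all add: torus_def)
  then show False
    using K(1) K'(1) not_planar_embeddable_if_K33_config by blast
qed

theorem not_toroidal_if_cube:
  fixes F :: "'c set \<Rightarrow> 'a"
  assumes S: "card S \<ge> 5" and inj: "inj_on F (Pow S)" and V: "F ` Pow S \<subseteq> verts G"
    and E: "\<And>A k. A \<subseteq> S \<Longrightarrow> k \<in> S - A \<Longrightarrow> {F A, F (insert k A)} \<in> undirected_edges G"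
  shows "\<not> toroidal G"
proof
  assume "toroidal G"
  then obtain \<phi> \<gamma> where "drawing_in torus G \<phi> \<gamma>" unfolding toroidal_def by blast
  then interpret surface_drawing torus G \<phi> \<gamma> by unfold_locales
  obtain T where T: "T \<subseteq> S" "card T = 5" using S by (meson obtain_subset_with_card_n)
  then obtain xs where xs: "distinct xs" "set xs = T" "length xs = 5"
    by (metis card_ge_0_finite distinct_card finite_distinct_list zero_less_numeral)
  then obtain p q r s t where pqrst: "xs = [p, q, r, s, t]"
    by (auto simp: length_Suc_conv numeral_eq_Suc)
  have ne: "distinct [p, q, r, s, t]" using xs pqrst by simp
  have mem: "p \<in> S" "q \<in> S" "r \<in> S" "s \<in> S" "t \<in> S" using T xs pqrst by auto
  \<comment> \<open>The values \<open>{}\<close> and \<open>{t}\<close> of B select two opposite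
    4-dimensional faces; the order is the numbering of \<open>cube_K33_subdivision\<close>.\<close>
  define vs where "vs B = [B, {p} \<union> B, {q} \<union> B, {r} \<union> B, {p,q} \<union> B, {q,r} \<union> B, {p,r} \<union> B, {p,q,r} \<union> B,
      {s} \<union> B, {p,s} \<union> B, {q,s} \<union> B, {r,s} \<union> B]" for B
  have half: "\<exists>E \<subseteq> undirected_edges G. \<Union> E \<subseteq> F ` set (vs B) \<and> {} \<notin> E \<and> K33_config (edge_points E) \<and>
    (\<exists>g. path g \<and> path_image g = edge_points E)" if B: "B \<subseteq> {t}" for B
  proof -
    have E': "{F A, F A'} \<in> undirected_edges G" if "A \<subseteq> S" "k \<in> S - A" "A' = insert k A" for k A A'
      using E that by blast
    have E'': "{F A', F A} \<in> undirected_edges G" if "A \<subseteq> S" "k \<in> S - A" "A' = insert k A" for k A A'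
      using E[of A k] that by (simp add: insert_commute)
    have sub: "set (vs B) \<subseteq> Pow S" using B mem by (auto simp: vs_def)
    \<comment> \<open>Membership of p, q, r, s alone tells the twelve sets apart.\<close>
    have "distinct (map (\<lambda>A. (p \<in> A, q \<in> A, r \<in> A, s \<in> A)) (vs B))"
      using ne B by (auto simp: vs_def)
    then have "distinct (vs B)" by (simp add: distinct_map)
    then have d: "distinct (map F (vs B))" using sub inj by (auto simp: distinct_map intro: inj_on_subset)
    define f where "f i = F (vs B ! i)" for i
    have len: "length (vs B) = 12" by (simp add: vs_def)
    have f_map: "f i = map F (vs B) ! i" if "i < 12" for i
      using that len by (simp add: f_def)
    have "inj_on ((!) (map F (vs B))) {..<12}" using d len by (intro inj_on_nth) auto
    then have inj': "inj_on f {..<12}" using f_map by (simp add: inj_on_def)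
    have "f ` {..<12} = (!) (map F (vs B)) ` {..<12}" using f_map by (intro image_cong) simp_all
    then have im: "f ` {..<12} = F ` set (vs B)"
      using nth_image[of 12 "map F (vs B)"] len by (simp add: lessThan_atLeast0)
    have V': "f ` {..<12} \<subseteq> verts G" using order_trans[OF image_mono[OF sub] V] im by simp
    have BS: "B \<subseteq> S" "p \<notin> B" "q \<notin> B" "r \<notin> B" "s \<notin> B" using B mem ne by auto
    show ?thesis
      unfolding im[symmetric]
    proof (rule cube_K33_subdivision[OF inj' V'])
      show "{f 0, f 1} \<in> undirected_edges G"
        unfolding f_def by (rule E'[where k = p]) (use BS mem ne in \<open>auto simp: vs_def\<close>)
      show "{f 0, f 2} \<in> undirected_edges G"
        unfolding f_def by (rule E'[where k = q]) (use BS mem ne in \<open>auto simp: vs_def\<close>)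
      show "{f 0, f 3} \<in> undirected_edges G"
        unfolding f_def by (rule E'[where k = r]) (use BS mem ne in \<open>auto simp: vs_def\<close>)
      show "{f 1, f 4} \<in> undirected_edges G"
        unfolding f_def by (rule E'[where k = q]) (use BS mem ne in \<open>auto simp: vs_def\<close>)
      show "{f 2, f 5} \<in> undirected_edges G"
        unfolding f_def by (rule E'[where k = r]) (use BS mem ne in \<open>auto simp: vs_def\<close>)
      show "{f 3, f 6} \<in> undirected_edges G"
        unfolding f_def by (rule E'[where k = p]) (use BS mem ne in \<open>auto simp: vs_def\<close>)
      show "{f 4, f 7} \<in> undirected_edges G"
        unfolding f_def by (rule E'[where k = r]) (use BS mem ne in \<open>auto simp: vs_def\<close>)
      show "{f 5, f 7} \<in> undirected_edges G"
        unfolding f_def by (rule E'[where k = p]) (use BS mem ne in \<open>auto simp: vs_def\<close>)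
      show "{f 6, f 7} \<in> undirected_edges G"
        unfolding f_def by (rule E'[where k = q]) (use BS mem ne in \<open>auto simp: vs_def\<close>)
      show "{f 8, f 9} \<in> undirected_edges G"
        unfolding f_def by (rule E'[where k = p]) (use BS mem ne in \<open>auto simp: vs_def\<close>)
      show "{f 8, f 10} \<in> undirected_edges G"
        unfolding f_def by (rule E'[where k = q]) (use BS mem ne in \<open>auto simp: vs_def\<close>)
      show "{f 8, f 11} \<in> undirected_edges G"
        unfolding f_def by (rule E'[where k = r]) (use BS mem ne in \<open>auto simp: vs_def\<close>)
      show "{f 9, f 1} \<in> undirected_edges G"
        unfolding f_def by (rule E''[where k = s]) (use BS mem ne in \<open>auto simp: vs_def\<close>)
      show "{f 10, f 2} \<in> undirected_edges G"
        unfolding f_def by (rule E''[where k = s]) (use BS mem ne in \<open>auto simp: vs_def\<close>)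
      show "{f 11, f 3} \<in> undirected_edges G"
        unfolding f_def by (rule E''[where k = s]) (use BS mem ne in \<open>auto simp: vs_def\<close>)
    qed
  qed
  obtain E1 where E1: "E1 \<subseteq> undirected_edges G" "\<Union> E1 \<subseteq> F ` set (vs {})" "{} \<notin> E1" "K33_config (edge_points E1)"
    "\<exists>g. path g \<and> path_image g = edge_points E1" using half[of "{}"] by auto
  obtain E2 where E2: "E2 \<subseteq> undirected_edges G" "\<Union> E2 \<subseteq> F ` set (vs {t})" "{} \<notin> E2" "K33_config (edge_points E2)"
    "\<exists>g. path g \<and> path_image g = edge_points E2" using half[of "{t}"] by auto
  have "F ` set (vs {}) \<inter> F ` set (vs {t}) = F ` (set (vs {}) \<inter> set (vs {t}))"
    using mem by (intro inj_on_image_Int[OF inj, symmetric]) (auto simp: vs_def)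
  also have "set (vs {}) \<inter> set (vs {t}) = {}"
  proof -
    have "t \<notin> A" if "A \<in> set (vs {})" for A using that ne by (auto simp: vs_def)
    moreover have "t \<in> A" if "A \<in> set (vs {t})" for A using that ne by (auto simp: vs_def)
    ultimately show ?thesis by blast
  qed
  finally have "\<Union> E1 \<inter> \<Union> E2 = {}" using E1(2) E2(2) by blast
  then show False
    using disjoint_K33_subdivisions_not_in_torus[OF surface_drawing_axioms E1(1) E2(1) _ E1(3,4,5) E2(4,5)] by blast
qed

section \<open>Bruhat graphs and patterns\<close>

lemma transpose_eq_if: "Transposition.transpose i j x = (if x = i then j else if x = j then i else x)"
  by (simp add: Transposition.transpose_def)

text \<open>An inversion of the product is sent to its transposed pair if that is still increasing,
  and to itself otherwise. This injects into the inversions of \<tau> and misses (i, j).\<close>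

lemma card_inversions_transpose_less:
  assumes ij: "i < j" "i \<in> {1..n}" "j \<in> {1..n}" and less: "\<tau> j < \<tau> i"
  shows "card (inversions n (\<tau> \<circ> Transposition.transpose i j)) < card (inversions n \<tau>)"
proof -
  let ?t = "Transposition.transpose i j"
  define f where "f = (\<lambda>(a, b). if ?t a < ?t b then (?t a, ?t b) else (a, b))"
  have "card (inversions n (\<tau> \<circ> ?t)) \<le> card (inversions n \<tau> - {(i, j)})"
  proof (rule card_inj_on_le)
    show "finite (inversions n \<tau> - {(i, j)})" by (simp add: finite_inversions)
    show "inj_on f (inversions n (\<tau> \<circ> ?t))"
      using ij less
      by (auto simp: inj_on_def f_def inversions_def transpose_eq_if split: if_splits)
    show "f ` inversions n (\<tau> \<circ> ?t) \<subseteq> inversions n \<tau> - {(i, j)}"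
    proof (rule image_subsetI)
      fix p assume p: "p \<in> inversions n (\<tau> \<circ> ?t)"
      obtain a b where p_eq: "p = (a, b)" by (cases p)
      have ab: "a \<in> {1..n}" "b \<in> {1..n}" "a < b" "\<tau> (?t b) < \<tau> (?t a)"
        using p unfolding p_eq by (auto simp: inversions_def)
      show "f p \<in> inversions n \<tau> - {(i, j)}"
      proof (cases "?t a < ?t b")
        case True
        have "?t a \<in> {1..n}" "?t b \<in> {1..n}" using ij ab by (simp_all add: transpose_eq_if)
        moreover have "(?t a, ?t b) \<noteq> (i, j)" using ij(1) ab(3) by (auto simp: transpose_eq_if split: if_splits)
        ultimately show ?thesis using True ab(4) by (simp add: p_eq f_def inversions_def)
      next
        case False
        \<comment> \<open>The transposition reverses only pairs that start at i or end at j and lie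
          within the interval from i to j; (i, j) itself is no inversion of the product.\<close>
        have "a = i \<and> b < j \<or> b = j \<and> i < a"
          using False ab(3,4) ij(1) less unfolding transpose_eq_if by (auto split: if_splits)
        then have "\<tau> b < \<tau> a" "(a, b) \<noteq> (i, j)"
          using ab(3,4) ij(1) less unfolding transpose_eq_if by (auto split: if_splits)
        then show ?thesis using False ab by (simp add: p_eq f_def inversions_def)
      qed
    qed
  qed
  moreover have "(i, j) \<in> inversions n \<tau>" using ij less by (simp add: inversions_def)
  ultimately show ?thesis
    using card_Diff1_less[OF finite_inversions, of "(i, j)"] by fastforce
qed

lemma permutes_comp_transpose:
  assumes "\<tau> permutes A" "i \<in> A" "j \<in> A"
  shows "\<tau> \<circ> Transposition.transpose i j permutes A"
  by (rule permutes_compose[OF permutes_swap_id[OF assms(2,3)] assms(1)])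

text \<open>This removes the length from the definition. If the values at i < j were increasing in
  \<tau>, they would be decreasing in \<sigma>, and the previous lemma with both roles exchanged
  would make \<tau> shorter.\<close>

lemma bruhat_step_iff:
  "bruhat_step n \<sigma> \<tau> \<longleftrightarrow> \<tau> permutes {1..n} \<and>
     (\<exists>i j. i \<in> {1..n} \<and> j \<in> {1..n} \<and> i < j \<and> \<tau> j < \<tau> i \<and> \<sigma> = \<tau> \<circ> Transposition.transpose i j)"
  (is "?L \<longleftrightarrow> ?R")
proof
  assume ?R
  then obtain i j where ij: "i \<in> {1..n}" "j \<in> {1..n}" "i < j" "\<tau> j < \<tau> i" "\<sigma> = \<tau> \<circ> Transposition.transpose i j"
    and \<tau>: "\<tau> permutes {1..n}" by blast
  have \<sigma>: "\<sigma> permutes {1..n}" using permutes_comp_transpose[OF \<tau> ij(1,2)] ij(5) by simp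
  have "card (inversions n \<sigma>) < card (inversions n \<tau>)"
    unfolding ij(5) by (rule card_inversions_transpose_less) (use ij in blast)+
  then have "perm_length n \<sigma> < perm_length n \<tau>"
    unfolding perm_length_eq_card_inversions[OF \<sigma>] perm_length_eq_card_inversions[OF \<tau>] .
  then show ?L
    unfolding bruhat_step_def using \<sigma> \<tau> ij(3,5)
    by (intro conjI bexI[OF bexI[OF _ ij(2)] ij(1)]) auto
next
  assume L: ?L
  then obtain a b where ab: "a \<in> {1..n}" "b \<in> {1..n}" "a \<noteq> b" "\<sigma> = \<tau> \<circ> Transposition.transpose a b"
    unfolding bruhat_step_def by blast
  define i j where "i = min a b" and "j = max a b"
  have ij: "i \<in> {1..n}" "j \<in> {1..n}" "i < j" "\<sigma> = \<tau> \<circ> Transposition.transpose i j"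
    using ab by (auto simp: i_def j_def min_def max_def transpose_commute)
  have \<sigma>: "\<sigma> permutes {1..n}" and \<tau>: "\<tau> permutes {1..n}" and len: "perm_length n \<sigma> < perm_length n \<tau>"
    using L by (auto simp: bruhat_step_def)
  have "\<tau> j < \<tau> i"
  proof (rule ccontr)
    assume "\<not> \<tau> j < \<tau> i"
    moreover have "\<tau> i \<noteq> \<tau> j" using inj_eq[OF permutes_inj[OF \<tau>]] ij(3) by simp
    ultimately have "\<sigma> j < \<sigma> i" by (simp add: ij(4))
    have "\<sigma> \<circ> Transposition.transpose i j = \<tau>"
      by (simp only: ij(4) comp_assoc transpose_comp_involutory comp_id)
    with card_inversions_transpose_less[OF ij(3,1,2) \<open>\<sigma> j < \<sigma> i\<close>]
    have "card (inversions n \<tau>) < card (inversions n \<sigma>)" by simp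
    then show False
      using len unfolding perm_length_eq_card_inversions[OF \<sigma>] perm_length_eq_card_inversions[OF \<tau>] by simp
  qed
  then show ?R using \<tau> ij by blast
qed

lemma bruhat_stepI:
  "\<tau> permutes {1..n} \<Longrightarrow> i \<in> {1..n} \<Longrightarrow> j \<in> {1..n} \<Longrightarrow> i < j \<Longrightarrow> \<tau> j < \<tau> i \<Longrightarrow>
    bruhat_step n (\<tau> \<circ> Transposition.transpose i j) \<tau>"
  unfolding bruhat_step_iff by blast

lemma bruhat_step_permutes: "bruhat_step n \<sigma> \<tau> \<Longrightarrow> \<sigma> permutes {1..n} \<and> \<tau> permutes {1..n}"
  by (simp add: bruhat_step_def)

lemma bruhat_le_refl: "bruhat_le n \<sigma> \<sigma>"
  by (simp add: bruhat_le_def)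

lemma bruhat_le_step: "bruhat_step n \<rho> \<sigma> \<Longrightarrow> bruhat_le n \<sigma> \<tau> \<Longrightarrow> bruhat_le n \<rho> \<tau>"
  unfolding bruhat_le_def by (rule converse_rtranclp_into_rtranclp)

lemma bruhat_le_trans: "bruhat_le n \<rho> \<sigma> \<Longrightarrow> bruhat_le n \<sigma> \<tau> \<Longrightarrow> bruhat_le n \<rho> \<tau>"
  unfolding bruhat_le_def by (rule rtranclp_trans)

lemma bruhat_le_induct [consumes 1, case_names refl step]:
  assumes "bruhat_le n \<sigma> \<tau>" and "P \<tau>"
    and "\<And>\<rho> \<sigma>. bruhat_step n \<rho> \<sigma> \<Longrightarrow> bruhat_le n \<sigma> \<tau> \<Longrightarrow> P \<sigma> \<Longrightarrow> P \<rho>"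
  shows "P \<sigma>"
  using assms(1)[unfolded bruhat_le_def]
  by (induction rule: converse_rtranclp_induct) (use assms(2,3) in \<open>auto simp: bruhat_le_def\<close>)

lemma bruhat_le_permutes:
  assumes "bruhat_le n \<sigma> \<tau>" "\<tau> permutes {1..n}"
  shows "\<sigma> permutes {1..n}"
  using assms by (induction rule: bruhat_le_induct) (auto simp: bruhat_step_def)

lemma verts_bruhat_graph:
  "verts (bruhat_graph n \<pi>) = {\<sigma>. \<sigma> permutes {1..n} \<and> bruhat_le n \<sigma> \<pi>}"
  by (simp add: bruhat_graph_def induce_subgraph_def)

lemma undirected_edges_bruhat_graph:
  assumes "\<pi> permutes {1..n}"
  shows "undirected_edges (bruhat_graph n \<pi>)
    = (\<lambda>(\<sigma>, \<tau>). {\<sigma>, \<tau>}) ` {(\<sigma>, \<tau>). bruhat_step n \<sigma> \<tau> \<and> bruhat_le n \<tau> \<pi>}"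
proof -
  have "arcs (bruhat_graph n \<pi>) = {(\<sigma>, \<tau>). bruhat_step n \<sigma> \<tau> \<and> bruhat_le n \<tau> \<pi>}"
    using bruhat_le_step bruhat_step_permutes
    by (auto simp: bruhat_graph_def induce_subgraph_def full_bruhat_graph_def with_proj_simps)
  then show ?thesis
    by (simp add: undirected_edges_def case_prod_beta) (simp add: bruhat_graph_def induce_subgraph_def)
qed

section \<open>Embeddings of Bruhat graphs\<close>

lemma toroidal_subgraph:
  assumes inj: "inj_on f (verts G)" and V: "f ` verts G \<subseteq> verts H"
    and E: "\<And>e. e \<in> undirected_edges G \<Longrightarrow> e \<subseteq> verts G \<and> f ` e \<in> undirected_edges H"
    and H: "toroidal H"
  shows "toroidal G"
proof -
  obtain \<phi> \<gamma> where d: "drawing_in torus H \<phi> \<gamma>" using H by (auto simp: toroidal_def)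
  have "drawing_in torus G (\<phi> \<circ> f) (\<lambda>e. \<gamma> (f ` e))"
    unfolding drawing_in_def
  proof (intro conjI ballI impI)
    show "inj_on (\<phi> \<circ> f) (verts G)"
      using d inj V by (auto simp: drawing_in_def intro: comp_inj_on inj_on_subset)
    show "(\<phi> \<circ> f) ` verts G \<subseteq> torus"
      using d V by (auto simp: drawing_in_def)
  next
    fix e assume e: "e \<in> undirected_edges G"
    note fe = E[OF e]
    from d fe have *: "arc (\<gamma> (f ` e))" "path_image (\<gamma> (f ` e)) \<subseteq> torus"
      "{pathstart (\<gamma> (f ` e)), pathfinish (\<gamma> (f ` e))} = \<phi> ` f ` e"
      "path_image (\<gamma> (f ` e)) \<inter> \<phi> ` verts H = \<phi> ` f ` e"
      by (simp_all add: drawing_in_def)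
    then show "arc (\<gamma> (f ` e))" "path_image (\<gamma> (f ` e)) \<subseteq> torus"
      "{pathstart (\<gamma> (f ` e)), pathfinish (\<gamma> (f ` e))} = (\<phi> \<circ> f) ` e"
      by (simp_all add: image_comp)
    show "path_image (\<gamma> (f ` e)) \<inter> (\<phi> \<circ> f) ` verts G = (\<phi> \<circ> f) ` e"
    proof -
      have "\<phi> ` f ` verts G \<subseteq> \<phi> ` verts H" "\<phi> ` f ` e \<subseteq> \<phi> ` f ` verts G"
        using V fe by (auto intro!: image_mono)
      then show ?thesis unfolding image_comp[symmetric] using *(4) by blast
    qed
  next
    fix e e' assume e: "e \<in> undirected_edges G" "e' \<in> undirected_edges G" "e \<noteq> e'"
    note fe = E[OF e(1)] E[OF e(2)]
    have "f ` e \<noteq> f ` e'" using inj_on_image_eq_iff[OF inj] fe e(3) by simp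
    then have "path_image (\<gamma> (f ` e)) \<inter> path_image (\<gamma> (f ` e')) = \<phi> ` (f ` e \<inter> f ` e')"
      using d fe by (simp add: drawing_in_def)
    also have "f ` e \<inter> f ` e' = f ` (e \<inter> e')"
      using inj_on_image_Int[OF inj] fe by simp
    finally show "path_image (\<gamma> (f ` e)) \<inter> path_image (\<gamma> (f ` e')) = (\<phi> \<circ> f) ` (e \<inter> e')"
      by (simp add: image_comp)
  qed
  then show ?thesis by (auto simp: toroidal_def)
qed

text \<open>Used in both directions: to embed the graph of a pattern into that of \<sigma>, and the
  graph of a \<sigma> with small support into that of a pattern. Preserving the top element and the
  steps below it suffices, since the order is generated by steps.\<close>

lemma toroidal_bruhat_graph_embedding:
  assumes \<pi>: "\<pi> permutes {1..n}" and \<rho>: "\<rho> permutes {1..m}"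
    and inj: "inj_on \<psi> {\<sigma>. bruhat_le n \<sigma> \<pi>}" and top: "\<psi> \<pi> = \<rho>"
    and step: "\<And>\<sigma> \<tau>. bruhat_step n \<sigma> \<tau> \<Longrightarrow> bruhat_le n \<tau> \<pi> \<Longrightarrow> bruhat_step m (\<psi> \<sigma>) (\<psi> \<tau>)"
    and H: "toroidal (bruhat_graph m \<rho>)"
  shows "toroidal (bruhat_graph n \<pi>)"
proof (rule toroidal_subgraph[OF _ _ _ H])
  have le: "bruhat_le m (\<psi> \<sigma>) \<rho>" if "bruhat_le n \<sigma> \<pi>" for \<sigma>
    using that by (induction rule: bruhat_le_induct) (auto simp: top bruhat_le_refl intro: bruhat_le_step step)
  show "inj_on \<psi> (verts (bruhat_graph n \<pi>))"
    using inj by (rule inj_on_subset) (auto simp: verts_bruhat_graph)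
  show "\<psi> ` verts (bruhat_graph n \<pi>) \<subseteq> verts (bruhat_graph m \<rho>)"
    using le bruhat_le_permutes[OF _ \<rho>] by (auto simp: verts_bruhat_graph)
  show "e \<subseteq> verts (bruhat_graph n \<pi>) \<and> \<psi> ` e \<in> undirected_edges (bruhat_graph m \<rho>)"
    if e: "e \<in> undirected_edges (bruhat_graph n \<pi>)" for e
  proof -
    obtain \<sigma> \<tau> where st: "e = {\<sigma>, \<tau>}" "bruhat_step n \<sigma> \<tau>" "bruhat_le n \<tau> \<pi>"
      using e unfolding undirected_edges_bruhat_graph[OF \<pi>] by auto
    then have "bruhat_step m (\<psi> \<sigma>) (\<psi> \<tau>)" "bruhat_le m (\<psi> \<tau>) \<rho>" using step le by blast+
    then have "\<psi> ` e \<in> undirected_edges (bruhat_graph m \<rho>)"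
      unfolding undirected_edges_bruhat_graph[OF \<rho>] using st(1) by (intro image_eqI[of _ _ "(\<psi> \<sigma>, \<psi> \<tau>)"]) simp_all
    moreover have "e \<subseteq> verts (bruhat_graph n \<pi>)"
      using st bruhat_le_step[OF st(2,3)] by (auto simp: verts_bruhat_graph bruhat_step_def)
    ultimately show ?thesis by blast
  qed
qed

lemma toroidal_pattern:
  assumes \<sigma>: "\<sigma> permutes {1..n}" and \<pi>: "\<pi> permutes {1..m}" and con: "contains_pattern n \<sigma> m \<pi>"
    and tor: "toroidal (bruhat_graph n \<sigma>)"
  shows "toroidal (bruhat_graph m \<pi>)"
proof -
  obtain ix where ix: "strict_mono_on {1..m} ix" "ix ` {1..m} \<subseteq> {1..n}"
    and pat: "\<And>a b. a \<in> {1..m} \<Longrightarrow> b \<in> {1..m} \<Longrightarrow> \<sigma> (ix a) < \<sigma> (ix b) \<longleftrightarrow> \<pi> a < \<pi> b"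
    using con unfolding contains_pattern_def by blast
  have inj: "inj_on ix {1..m}" using strict_mono_on_imp_inj_on[OF ix(1)] .
  define \<theta> where "\<theta> w x = (if x \<in> ix ` {1..m} then ix (w (inv_into {1..m} ix x)) else x)" for w x
  have \<theta>_permutes: "\<theta> w permutes {1..n}" if "w permutes {1..m}" for w
  proof -
    have "\<theta> w permutes ix ` {1..m}"
      unfolding \<theta>_def using permutes_bij_inv_into[OF that inj_on_imp_bij_betw[OF inj]] .
    then show ?thesis using ix(2) by (rule permutes_subset)
  qed
  have \<theta>_ix: "\<theta> w (ix a) = ix (w a)" if "a \<in> {1..m}" for w a
    using that inj by (simp add: \<theta>_def)
  \<comment> \<open>Position \<open>ix a\<close> receives the value of \<sigma> that plays the part
    of the letter \<open>u a\<close> of \<pi>; the other positions keep their values. So the pattern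
    at the positions \<open>ix\<close> changes from \<pi> to u.\<close>
  define \<psi> where "\<psi> u = \<sigma> \<circ> \<theta> (inv \<pi> \<circ> u)" for u
  have inv_mem: "inv \<pi> c \<in> {1..m}" "\<pi> (inv \<pi> c) = c" if "c \<in> {1..m}" for c
    using permutes_in_image[OF permutes_inv[OF \<pi>]] that permutes_inverses(1)[OF \<pi>] by auto
  have \<psi>_ix: "\<psi> u (ix a) = \<sigma> (ix (inv \<pi> (u a)))" if "a \<in> {1..m}" for u a
    using \<theta>_ix[OF that] by (simp add: \<psi>_def)
  have \<psi>_less: "\<psi> u (ix a) < \<psi> u (ix b) \<longleftrightarrow> u a < u b"
    if u: "u permutes {1..m}" and a: "a \<in> {1..m}" "b \<in> {1..m}" for u a b
  proof -
    have "u a \<in> {1..m}" "u b \<in> {1..m}" using permutes_in_image[OF u] a by blast+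
    then show ?thesis using pat[of "inv \<pi> (u a)" "inv \<pi> (u b)"] inv_mem by (simp only: \<psi>_ix a)
  qed
  have \<psi>_permutes: "\<psi> u permutes {1..n}" if "u permutes {1..m}" for u
    unfolding \<psi>_def using that \<pi> \<sigma> by (intro permutes_compose \<theta>_permutes permutes_inv)
  have \<psi>_transpose: "\<psi> (u \<circ> Transposition.transpose i j) = \<psi> u \<circ> Transposition.transpose (ix i) (ix j)"
    if ij: "i \<in> {1..m}" "j \<in> {1..m}" for u i j
  proof
    fix x show "\<psi> (u \<circ> Transposition.transpose i j) x = (\<psi> u \<circ> Transposition.transpose (ix i) (ix j)) x"
    proof (cases "x \<in> ix ` {1..m}")
      case True
      then obtain a where a: "a \<in> {1..m}" "x = ix a" by blast
      then have "Transposition.transpose (ix i) (ix j) x = ix (Transposition.transpose i j a)"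
        using ij inj_on_eq_iff[OF inj] by (auto simp: transpose_eq_if)
      moreover have "Transposition.transpose i j a \<in> {1..m}" using a ij by (simp add: transpose_eq_if)
      ultimately show ?thesis using a by (simp add: \<psi>_ix)
    next
      case False
      then have "Transposition.transpose (ix i) (ix j) x = x" using ij by (auto simp: transpose_eq_if)
      then show ?thesis using False by (simp add: \<psi>_def \<theta>_def)
    qed
  qed
  show ?thesis
  proof (rule toroidal_bruhat_graph_embedding[OF \<pi> \<sigma> _ _ _ tor])
    show "\<psi> \<pi> = \<sigma>"
      using permutes_inv_o(2)[OF \<pi>] by (auto simp: \<psi>_def \<theta>_def fun_eq_iff f_inv_into_f)
    show "bruhat_step n (\<psi> u) (\<psi> v)" if "bruhat_step m u v" for u v
    proof -
      obtain i j where ij: "i \<in> {1..m}" "j \<in> {1..m}" "i < j" "v j < v i" "u = v \<circ> Transposition.transpose i j"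
        and v: "v permutes {1..m}" using \<open>bruhat_step m u v\<close> unfolding bruhat_step_iff by blast
      show ?thesis
        unfolding ij(5) \<psi>_transpose[OF ij(1,2)]
        using ij v ix \<psi>_permutes[OF v] \<psi>_less[OF v ij(2,1)]
        by (intro bruhat_stepI) (auto simp: strict_mono_on_def image_subset_iff)
    qed
    show "inj_on \<psi> {u. bruhat_le m u \<pi>}"
    proof (rule inj_onI, rule ext)
      fix u v a assume uv: "u \<in> {u. bruhat_le m u \<pi>}" "v \<in> {u. bruhat_le m u \<pi>}" "\<psi> u = \<psi> v"
      then have p: "u permutes {1..m}" "v permutes {1..m}" using bruhat_le_permutes[OF _ \<pi>] by auto
      show "u a = v a"
      proof (cases "a \<in> {1..m}")
        case True
        then have m: "u a \<in> {1..m}" "v a \<in> {1..m}" using permutes_in_image[OF p(1), of a] permutes_in_image[OF p(2), of a] by blast+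
        have "\<sigma> (ix (inv \<pi> (u a))) = \<sigma> (ix (inv \<pi> (v a)))"
          using uv(3) \<psi>_ix[OF True] by metis
        then have "ix (inv \<pi> (u a)) = ix (inv \<pi> (v a))" using permutes_inj[OF \<sigma>] by (simp add: inj_eq)
        then have "inv \<pi> (u a) = inv \<pi> (v a)" using inj_onD[OF inj] inv_mem m by blast
        then show ?thesis using inv_mem m by metis
      next
        case False
        then show ?thesis using p by (simp add: permutes_def)
      qed
    qed
  qed
qed

section \<open>Patterns on prescribed positions\<close>

lemma ex_standardization:
  fixes f :: "nat \<Rightarrow> nat"
  assumes inj: "inj_on f {1..m}"
  shows "\<exists>\<pi>. \<pi> permutes {1..m} \<and> (\<forall>a\<in>{1..m}. \<forall>b\<in>{1..m}. f a < f b \<longleftrightarrow> \<pi> a < \<pi> b)"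
proof -
  define \<pi> where "\<pi> a = (if a \<in> {1..m} then card {b \<in> {1..m}. f b \<le> f a} else a)" for a
  have mono: "\<pi> a < \<pi> b" if "a \<in> {1..m}" "b \<in> {1..m}" "f a < f b" for a b
  proof -
    have "{c \<in> {1..m}. f c \<le> f a} \<subset> {c \<in> {1..m}. f c \<le> f b}"
      using that by (auto intro!: psubsetI simp: set_eq_iff) (metis leD le_refl)
    then show ?thesis using that by (simp add: \<pi>_def psubset_card_mono)
  qed
  have iff: "f a < f b \<longleftrightarrow> \<pi> a < \<pi> b" if "a \<in> {1..m}" "b \<in> {1..m}" for a b
    using mono[OF that] mono[OF that(2,1)] inj_on_eq_iff[OF inj that] by (metis linorder_neqE_nat less_asym less_irrefl)
  have "inj_on \<pi> {1..m}"
    using iff inj by (intro inj_onI) (metis inj_onD less_irrefl linorder_neqE_nat)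
  moreover have "\<pi> ` {1..m} \<subseteq> {1..m}"
  proof
    fix y assume "y \<in> \<pi> ` {1..m}"
    then obtain a where a: "a \<in> {1..m}" "y = \<pi> a" by blast
    have "card {b \<in> {1..m}. f b \<le> f a} \<le> card {1..m}" by (intro card_mono) auto
    moreover have "card {b \<in> {1..m}. f b \<le> f a} > 0" using a by (subst card_gt_0_iff) auto
    ultimately show "y \<in> {1..m}" using a by (simp add: \<pi>_def)
  qed
  ultimately have "bij_betw \<pi> {1..m} {1..m}" by (simp add: bij_betw_def endo_inj_surj)
  then have "\<pi> permutes {1..m}" by (rule bij_imp_permutes) (simp only: \<pi>_def if_False)
  then show ?thesis using iff by blast
qed

lemma ex_pattern_on:
  fixes \<sigma> :: "nat \<Rightarrow> nat"
  assumes \<sigma>: "\<sigma> permutes {1..n}" and M: "M \<subseteq> {1..n}"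
  obtains ix \<pi> where "strict_mono_on {1..card M} ix" "ix ` {1..card M} = M" "\<pi> permutes {1..card M}"
    "\<And>a b. a \<in> {1..card M} \<Longrightarrow> b \<in> {1..card M} \<Longrightarrow> \<sigma> (ix a) < \<sigma> (ix b) \<longleftrightarrow> \<pi> a < \<pi> b"
proof -
  have "finite M" using finite_subset[OF M finite_atLeastAtMost] .
  then obtain h where h: "bij_betw h {..<card M} M" "strict_mono_on {..<card M} h"
    by (rule ex_bij_betw_strict_mono_card)
  define ix where "ix a = h (a - 1)" for a
  have mono: "strict_mono_on {1..card M} ix"
    unfolding ix_def by (intro strict_mono_onI strict_mono_onD[OF h(2)]) auto
  have "ix ` Suc ` {..<card M} = M"
    using bij_betw_imp_surj_on[OF h(1)] by (simp add: ix_def image_image)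
  then have im: "ix ` {1..card M} = M"
    by (simp add: image_Suc_lessThan)
  have "inj_on (\<sigma> \<circ> ix) {1..card M}"
    using strict_mono_on_imp_inj_on[OF mono] permutes_inj_on[OF \<sigma>] by (intro comp_inj_on)
  from ex_standardization[OF this] obtain \<pi> where "\<pi> permutes {1..card M}"
    "\<forall>a\<in>{1..card M}. \<forall>b\<in>{1..card M}. \<sigma> (ix a) < \<sigma> (ix b) \<longleftrightarrow> \<pi> a < \<pi> b" by auto
  then show ?thesis using that mono im by blast
qed

section \<open>The support of a permutation\<close>

text \<open>The set of those \<open>k\<close> for which the simple transposition \<open>(k k+1)\<close> occurs in the reduced words of \<open>\<pi>\<close>.\<close>

definition support :: "nat \<Rightarrow> (nat \<Rightarrow> nat) \<Rightarrow> nat set" where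
  "support n \<pi> = {k. \<exists>i j. i \<in> {1..n} \<and> j \<in> {1..n} \<and> i \<le> k \<and> k < j \<and> \<pi> j < \<pi> i}"

lemma supportI:
  "i \<in> {1..n} \<Longrightarrow> j \<in> {1..n} \<Longrightarrow> i \<le> k \<Longrightarrow> k < j \<Longrightarrow> \<pi> j < \<pi> i \<Longrightarrow> k \<in> support n \<pi>"
  unfolding support_def by blast

lemma not_in_supportD:
  "k \<notin> support n \<pi> \<Longrightarrow> i \<in> {1..n} \<Longrightarrow> j \<in> {1..n} \<Longrightarrow> i \<le> k \<Longrightarrow> k < j \<Longrightarrow> \<pi> i \<le> \<pi> j"
  using supportI[of i n j k \<pi>] by linarith

lemma support_subset: "support n \<pi> \<subseteq> {1..<n}"
  by (auto simp: support_def)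

lemma finite_support: "finite (support n \<pi>)"
  by (rule finite_subset[OF support_subset]) simp

text \<open>If k is not in the support, no inversion of \<tau> straddles the cut after k. The
  transposed positions then lie on the same side of this cut, so their exchange creates no inversion
  across it.\<close>

lemma support_bruhat_step:
  assumes "bruhat_step n \<sigma> \<tau>"
  shows "support n \<sigma> \<subseteq> support n \<tau>"
proof
  fix k assume "k \<in> support n \<sigma>"
  then obtain a b where ab: "a \<in> {1..n}" "b \<in> {1..n}" "a \<le> k" "k < b" "\<sigma> b < \<sigma> a"
    unfolding support_def by blast
  obtain i j where ij: "i \<in> {1..n}" "j \<in> {1..n}" "i < j" "\<tau> j < \<tau> i" "\<sigma> = \<tau> \<circ> Transposition.transpose i j"
    using assms unfolding bruhat_step_iff by blast
  show "k \<in> support n \<tau>"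
  proof (rule ccontr)
    assume k: "k \<notin> support n \<tau>"
    have "\<not> (i \<le> k \<and> k < j)" using not_in_supportD[OF k ij(1,2)] ij(4) by linarith
    then have "Transposition.transpose i j a \<le> k" "k < Transposition.transpose i j b"
      using ab ij(3) by (auto simp: transpose_eq_if)
    moreover have "Transposition.transpose i j a \<in> {1..n}" "Transposition.transpose i j b \<in> {1..n}"
      using ab ij by (simp_all add: transpose_eq_if)
    ultimately have "\<sigma> a \<le> \<sigma> b"
      using not_in_supportD[OF k] by (simp add: ij(5))
    then show False using ab(5) by simp
  qed
qed

lemma support_bruhat_le: "bruhat_le n \<sigma> \<tau> \<Longrightarrow> support n \<sigma> \<subseteq> support n \<tau>"
proof (induction rule: bruhat_le_induct)
  case (step \<rho> \<sigma>)
  then show ?case using order_trans[OF support_bruhat_step[OF step(1)]] by simp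
qed simp

text \<open>For l other than k, the transposition of k and k + 1 maps \<open>{1..l}\<close> to
  itself, so an inversion across the cut after l comes from one of \<tau>.\<close>

lemma support_comp_adjacent:
  assumes k: "k \<in> {1..<n}"
  shows "support n (\<tau> \<circ> Transposition.transpose k (k + 1)) \<subseteq> insert k (support n \<tau>)"
proof
  let ?s = "Transposition.transpose k (k + 1)"
  fix l assume "l \<in> support n (\<tau> \<circ> ?s)"
  then obtain i j where ij: "i \<in> {1..n}" "j \<in> {1..n}" "i \<le> l" "l < j" "\<tau> (?s j) < \<tau> (?s i)"
    unfolding support_def by auto
  show "l \<in> insert k (support n \<tau>)"
  proof (cases "l = k")
    case False
    then have "?s i \<le> l" "l < ?s j" using ij by (auto simp: transpose_eq_if)
    moreover have "?s i \<in> {1..n}" "?s j \<in> {1..n}" using ij k by (auto simp: transpose_eq_if)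
    ultimately show ?thesis using ij(5) unfolding support_def by blast
  qed simp
qed

lemma bruhat_step_comp_adjacent_greater:
  assumes \<tau>: "\<tau> permutes {1..n}" and k: "k \<in> {1..<n}" "k \<notin> support n \<tau>"
  shows "bruhat_step n \<tau> (\<tau> \<circ> Transposition.transpose k (k + 1))"
proof -
  let ?s = "Transposition.transpose k (k + 1)"
  have "\<tau> k \<noteq> \<tau> (k + 1)" using inj_eq[OF permutes_inj[OF \<tau>]] by simp
  then have "\<tau> k < \<tau> (k + 1)"
    using not_in_supportD[OF k(2), of k "k + 1"] k(1) by auto
  moreover have "\<tau> \<circ> ?s permutes {1..n}" using k by (intro permutes_comp_transpose[OF \<tau>]) auto
  ultimately have "bruhat_step n ((\<tau> \<circ> ?s) \<circ> ?s) (\<tau> \<circ> ?s)"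
    using k by (intro bruhat_stepI) auto
  then show ?thesis by (simp only: comp_assoc transpose_comp_involutory comp_id)
qed

text \<open>The step transposes an inversion i < j of \<tau>, which cannot straddle the cut after k.
  So the adjacent transposition keeps i and j in order, and conjugating (i j) by it gives the step
  between the products.\<close>

lemma bruhat_step_comp_adjacent:
  assumes st: "bruhat_step n \<sigma> \<tau>" and k: "k \<in> {1..<n}" "k \<notin> support n \<tau>"
  shows "bruhat_step n (\<sigma> \<circ> Transposition.transpose k (k + 1)) (\<tau> \<circ> Transposition.transpose k (k + 1))"
proof -
  let ?s = "Transposition.transpose k (k + 1)"
  obtain i j where ij: "i \<in> {1..n}" "j \<in> {1..n}" "i < j" "\<tau> j < \<tau> i" "\<sigma> = \<tau> \<circ> Transposition.transpose i j"
    and \<tau>: "\<tau> permutes {1..n}"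
    using st unfolding bruhat_step_iff by blast
  have "\<not> (i \<le> k \<and> k < j)" using not_in_supportD[OF k(2) ij(1,2)] ij(4) by linarith
  then have "?s i < ?s j" using ij(3) by (auto simp: transpose_eq_if)
  moreover have "\<tau> \<circ> ?s permutes {1..n}" using k by (intro permutes_comp_transpose[OF \<tau>]) auto
  moreover have "?s i \<in> {1..n}" "?s j \<in> {1..n}" using ij k by (auto simp: transpose_eq_if)
  moreover have "(\<tau> \<circ> ?s) (?s j) < (\<tau> \<circ> ?s) (?s i)" using ij(4) by simp
  ultimately have "bruhat_step n ((\<tau> \<circ> ?s) \<circ> Transposition.transpose (?s i) (?s j)) (\<tau> \<circ> ?s)"
    by (intro bruhat_stepI)
  also have "(\<tau> \<circ> ?s) \<circ> Transposition.transpose (?s i) (?s j) = \<sigma> \<circ> ?s"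
    by (auto simp: ij(5) fun_eq_iff transpose_eq_if)
  finally show ?thesis .
qed

lemma bruhat_le_comp_adjacent:
  assumes "bruhat_le n \<sigma> \<tau>" and k: "k \<in> {1..<n}" "k \<notin> support n \<tau>"
  shows "bruhat_le n (\<sigma> \<circ> Transposition.transpose k (k + 1)) (\<tau> \<circ> Transposition.transpose k (k + 1))"
  using assms(1)
proof (induction rule: bruhat_le_induct)
  case (step \<rho> \<sigma>)
  then have "k \<notin> support n \<sigma>" using support_bruhat_le k(2) by blast
  then show ?case using bruhat_step_comp_adjacent[OF step(1) k(1)] step(3) bruhat_le_step by blast
qed (rule bruhat_le_refl)

lemma support_eq_empty_if_no_descent:
  assumes "\<And>k. k \<in> {1..<n} \<Longrightarrow> \<pi> k \<le> \<pi> (k + 1)"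
  shows "support n \<pi> = {}"
proof -
  have "\<pi> i \<le> \<pi> j" if "i \<le> j" "1 \<le> i" "j \<le> n" for i j
    using that
  proof (induction j rule: dec_induct)
    case (step m)
    then show ?case using assms[of m] by simp
  qed simp
  then have "\<not> (i \<in> {1..n} \<and> j \<in> {1..n} \<and> i \<le> k \<and> k < j \<and> \<pi> j < \<pi> i)" for i j k
    by (metis atLeastAtMost_iff le_less_trans less_imp_le not_less)
  then show ?thesis unfolding support_def by blast
qed

text \<open>If \<open>\<pi> = \<rho> s\<^sub>k\<close> with \<open>k\<close> not in the support of \<open>\<rho>\<close>, then the cube below \<open>\<pi>\<close> is the product of the
  cube below \<open>\<rho>\<close> with the edge \<open>id \<rightarrow> s\<^sub>k\<close>.\<close>

lemma ex_cube_below: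
  assumes "\<pi> permutes {1..n}"
  shows "\<exists>F. \<forall>A\<subseteq>support n \<pi>. bruhat_le n (F A) \<pi> \<and> support n (F A) = A \<and>
    (\<forall>k\<in>support n \<pi> - A. bruhat_step n (F A) (F (insert k A)))"
  using assms
proof (induction "perm_length n \<pi>" arbitrary: \<pi> rule: less_induct)
  case less
  show ?case
  proof (cases "\<exists>k\<in>{1..<n}. \<pi> (k + 1) < \<pi> k")
    case False
    then have "support n \<pi> = {}"
      by (intro support_eq_empty_if_no_descent) (auto simp: not_less)
    then show ?thesis by (intro exI[of _ "\<lambda>_. \<pi>"]) (simp add: bruhat_le_refl)
  next
    case True
    then obtain k where k: "k \<in> {1..<n}" "\<pi> (k + 1) < \<pi> k" by blast
    let ?s = "Transposition.transpose k (k + 1)"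
    define \<rho> where "\<rho> = \<pi> \<circ> ?s"
    have \<pi>_eq: "\<pi> = \<rho> \<circ> ?s" by (simp only: \<rho>_def comp_assoc transpose_comp_involutory comp_id)
    have st: "bruhat_step n \<rho> \<pi>"
      unfolding \<rho>_def using k less.prems by (intro bruhat_stepI) auto
    then have \<rho>: "\<rho> permutes {1..n}" and len: "perm_length n \<rho> < perm_length n \<pi>"
      by (auto simp: bruhat_step_def)
    obtain F where F0: "\<forall>A\<subseteq>support n \<rho>. bruhat_le n (F A) \<rho> \<and> support n (F A) = A \<and>
        (\<forall>k\<in>support n \<rho> - A. bruhat_step n (F A) (F (insert k A)))"
      by (rule exE[OF less.hyps[OF len \<rho>]])
    have F: "bruhat_le n (F A) \<rho>" "support n (F A) = A"
      "l \<in> support n \<rho> - A \<Longrightarrow> bruhat_step n (F A) (F (insert l A))"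
      if "A \<subseteq> support n \<rho>" for A l
      using F0 that by simp_all
    have le: "bruhat_le n u \<pi>" if "bruhat_le n u \<rho>" for u
      using that st bruhat_le_step[OF st bruhat_le_refl] bruhat_le_trans by blast
    have kn: "k \<in> {1..n}" "k + 1 \<in> {1..n}" using k(1) by auto
    have k_supp: "k \<in> support n \<pi>" using supportI[OF kn _ _ k(2)] by simp
    have supp1: "support n \<pi> \<subseteq> insert k (support n \<rho>)"
      using support_comp_adjacent[OF k(1), of \<rho>] unfolding \<pi>_eq[symmetric] .
    have supp2: "support n \<rho> \<subseteq> support n \<pi>"
      by (rule support_bruhat_step[OF st])
    show ?thesis
    proof (cases "k \<in> support n \<rho>")
      case True
      \<comment> \<open>The descent k may occur a second time in a reduced word; then the cube below
        \<rho> already has full rank.\<close>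
      then have "support n \<rho> = support n \<pi>" using supp1 supp2 by blast
      then show ?thesis using F le by (intro exI[of _ F]) simp
    next
      case False
      define F' where "F' A = (if k \<in> A then F (A - {k}) \<circ> ?s else F A)" for A
      have perm: "F A permutes {1..n}" if "A \<subseteq> support n \<rho>" for A
        using bruhat_le_permutes[OF F(1)[OF that] \<rho>] .
      have "bruhat_le n (F' A) \<pi> \<and> support n (F' A) = A \<and>
          (\<forall>l\<in>support n \<pi> - A. bruhat_step n (F' A) (F' (insert l A)))" if A: "A \<subseteq> support n \<pi>" for A
      proof (cases "k \<in> A")
        case kA: False
        then have A': "A \<subseteq> support n \<rho>" using A supp1 kA by blast
        have "bruhat_step n (F' A) (F' (insert l A))" if l: "l \<in> support n \<pi> - A" for l
        proof (cases "l = k")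
          case True
          then show ?thesis
            using bruhat_step_comp_adjacent_greater[OF perm[OF A'] k(1)] F(2)[OF A'] kA by (simp add: F'_def)
        next
          case False
          then show ?thesis using F(3)[OF A', of l] l supp1 kA by (auto simp: F'_def)
        qed
        then show ?thesis using F(1,2)[OF A'] le kA by (simp add: F'_def)
      next
        case kA: True
        define B where "B = A - {k}"
        have B: "B \<subseteq> support n \<rho>" "k \<notin> B" "A = insert k B" using A supp1 kA by (auto simp: B_def)
        have F'A: "F' A = F B \<circ> ?s" using kA by (simp add: F'_def B_def)
        \<comment> \<open>The prescribed supports pay off here: \<open>F B\<close> has support B,
          which omits k, so multiplication by the adjacent transposition goes up.\<close>
        have stB: "bruhat_step n (F B) (F B \<circ> ?s)"
          using bruhat_step_comp_adjacent_greater[OF perm[OF B(1)] k(1)] F(2)[OF B(1)] B(2) by simp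
        have "k \<in> support n (F B \<circ> ?s)"
        proof -
          have "F B k \<noteq> F B (k + 1)" using inj_eq[OF permutes_inj[OF perm[OF B(1)]]] by simp
          then have "F B k < F B (k + 1)"
            using not_in_supportD[of k n "F B" k "k + 1"] F(2)[OF B(1)] B(2) kn by auto
          then show ?thesis using supportI[OF kn, of k "F B \<circ> ?s"] by simp
        qed
        then have "support n (F' A) = A"
          unfolding F'A using support_comp_adjacent[OF k(1), of "F B"] support_bruhat_step[OF stB] F(2)[OF B(1)] B(3)
          by blast
        moreover have "bruhat_le n (F' A) \<pi>"
          unfolding F'A using bruhat_le_comp_adjacent[OF F(1)[OF B(1)] k(1) False] \<pi>_eq by simp
        moreover have "bruhat_step n (F' A) (F' (insert l A))" if l: "l \<in> support n \<pi> - A" for l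
        proof -
          have l': "l \<in> support n \<rho> - B" "l \<noteq> k" using l supp1 kA B(3) by auto
          then have "insert l B \<subseteq> support n \<rho>" using B(1) by blast
          then have "k \<notin> support n (F (insert l B))" using F(2) l'(2) B(2) by simp
          then have "bruhat_step n (F B \<circ> ?s) (F (insert l B) \<circ> ?s)"
            using bruhat_step_comp_adjacent[OF F(3)[OF B(1) l'(1)] k(1)] by simp
          moreover have "insert l A - {k} = insert l B" using l'(2) by (auto simp: B_def)
          ultimately show ?thesis using kA F'A by (simp add: F'_def)
        qed
        ultimately show ?thesis by blast
      qed
      then show ?thesis by (intro exI[of _ F']) blast
    qed
  qed
qed

text \<open>The support of the pattern of \<open>\<sigma>\<close> on the positions \<open>M\<close>, as a subset of \<open>M\<close>.\<close>

definition pattern_support :: "nat set \<Rightarrow> (nat \<Rightarrow> nat) \<Rightarrow> nat set" where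
  "pattern_support M \<sigma> = {x \<in> M. \<exists>i\<in>M. \<exists>j\<in>M. i \<le> x \<and> x < j \<and> \<sigma> j < \<sigma> i}"

lemma pattern_support_mono: "M \<subseteq> N \<Longrightarrow> pattern_support M \<sigma> \<subseteq> pattern_support N \<sigma>"
  unfolding pattern_support_def by blast

lemma pattern_support_interval: "pattern_support {1..n} \<sigma> = support n \<sigma>"
proof
  show "pattern_support {1..n} \<sigma> \<subseteq> support n \<sigma>"
    unfolding pattern_support_def support_def by blast
  show "support n \<sigma> \<subseteq> pattern_support {1..n} \<sigma>"
  proof
    fix k assume "k \<in> support n \<sigma>"
    then obtain i j where ij: "i \<in> {1..n}" "j \<in> {1..n}" "i \<le> k" "k < j" "\<sigma> j < \<sigma> i"
      unfolding support_def by blast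
    moreover from ij have "k \<in> {1..n}" by auto
    ultimately show "k \<in> pattern_support {1..n} \<sigma>" unfolding pattern_support_def by blast
  qed
qed

lemma card_support_pattern:
  assumes ix: "strict_mono_on {1..m} ix" "ix ` {1..m} = M"
    and pat: "\<And>a b. a \<in> {1..m} \<Longrightarrow> b \<in> {1..m} \<Longrightarrow> \<sigma> (ix a) < \<sigma> (ix b) \<longleftrightarrow> \<pi> a < \<pi> b"
  shows "card (support m \<pi>) = card (pattern_support M \<sigma>)"
proof -
  have less: "ix a < ix b \<longleftrightarrow> a < b" "ix a \<le> ix b \<longleftrightarrow> a \<le> b" if "a \<in> {1..m}" "b \<in> {1..m}" for a b
    using that strict_mono_on_less[OF ix(1)] strict_mono_on_less_eq[OF ix(1)] by auto
  have "(\<exists>i\<in>M. \<exists>j\<in>M. i \<le> ix a \<and> ix a < j \<and> \<sigma> j < \<sigma> i) \<longleftrightarrow>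
      (\<exists>i\<in>{1..m}. \<exists>j\<in>{1..m}. i \<le> a \<and> a < j \<and> \<pi> j < \<pi> i)" if "a \<in> {1..m}" for a
    unfolding ix(2)[symmetric] bex_simps by (simp only: less pat that cong: bex_cong)
  then have "ix ` pattern_support {1..m} \<pi> = pattern_support M \<sigma>"
    unfolding pattern_support_def using ix(2) by blast
  moreover have "inj_on ix (pattern_support {1..m} \<pi>)"
    using strict_mono_on_imp_inj_on[OF ix(1)] by (rule inj_on_subset) (auto simp: pattern_support_def)
  ultimately show ?thesis
    using card_image pattern_support_interval by metis
qed

text \<open>A missing element x with its inversion i, j involves three positions, but two suffice.
  If i is already in the support on M, then i belongs to M and x and j are added; otherwise i and j
  are added, and i itself becomes a new element.\<close>

lemma ex_small_pattern_support:
  assumes N: "finite N" and r: "r \<le> card (pattern_support N \<sigma>)"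
  shows "\<exists>M\<subseteq>N. card M \<le> 2 * r \<and> r \<le> card (pattern_support M \<sigma>)"
  using r
proof (induction r)
  case 0
  show ?case by (rule exI[of _ "{}"]) simp
next
  case (Suc r)
  then obtain M where M: "M \<subseteq> N" "card M \<le> 2 * r" "r \<le> card (pattern_support M \<sigma>)" by auto
  have fin: "finite (pattern_support M' \<sigma>)" if "M' \<subseteq> N" for M'
    using N that unfolding pattern_support_def by (auto intro: finite_subset)
  show ?case
  proof (cases "Suc r \<le> card (pattern_support M \<sigma>)")
    case True
    then show ?thesis using M by (intro exI[of _ M]) simp
  next
    case False
    then have "card (pattern_support M \<sigma>) < card (pattern_support N \<sigma>)" using Suc.prems by simp
    then have "\<not> pattern_support N \<sigma> \<subseteq> pattern_support M \<sigma>"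
      using card_mono[OF fin[OF M(1)]] by (meson not_le)
    then obtain x where x: "x \<in> pattern_support N \<sigma>" "x \<notin> pattern_support M \<sigma>" by blast
    then obtain i j where ij: "x \<in> N" "i \<in> N" "j \<in> N" "i \<le> x" "x < j" "\<sigma> j < \<sigma> i"
      unfolding pattern_support_def by blast
    \<comment> \<open>adding \<open>z\<close> and \<open>j\<close> to \<open>M\<close> makes \<open>z\<close> a new element of the support\<close>
    have "\<exists>z\<in>N. z \<notin> pattern_support M \<sigma> \<and> z \<in> pattern_support (M \<union> {z, j}) \<sigma>"
    proof (cases "i \<in> pattern_support M \<sigma>")
      case True
      then have "i \<in> M" by (simp add: pattern_support_def)
      then show ?thesis using x ij by (intro bexI[of _ x]) (auto simp: pattern_support_def)
    next
      case False
      then show ?thesis using x ij by (intro bexI[of _ i]) (auto simp: pattern_support_def)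
    qed
    then obtain z where z: "z \<in> N" "z \<notin> pattern_support M \<sigma>" "z \<in> pattern_support (M \<union> {z, j}) \<sigma>" by blast
    let ?M = "M \<union> {z, j}"
    have sub: "?M \<subseteq> N" using M ij z by blast
    have "card ?M \<le> card M + card {z, j}" by (rule card_Un_le)
    then have "card ?M \<le> 2 * Suc r" using M(2) card_insert_le_m1[of 2 "{j}" z] by simp
    moreover have "insert z (pattern_support M \<sigma>) \<subseteq> pattern_support ?M \<sigma>"
      using z pattern_support_mono[of M ?M \<sigma>] by blast
    then have "card (insert z (pattern_support M \<sigma>)) \<le> card (pattern_support ?M \<sigma>)"
      by (rule card_mono[OF fin[OF sub]])
    then have "Suc r \<le> card (pattern_support ?M \<sigma>)" using z(2) M fin[OF M(1)] by simp
    ultimately show ?thesis using sub by blast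
  qed
qed

text \<open>No inversion straddles the cuts just before and just after x, so smaller positions carry
  smaller values and larger positions larger ones. Hence exactly x - 1 values lie below
  \<open>u x\<close>.\<close>

lemma fixed_outside_support:
  assumes u: "u permutes {1..n}" and x: "x \<in> {1..n}" "x \<notin> support n u" "x - 1 \<notin> support n u"
  shows "u x = x"
proof -
  have inj: "u a \<noteq> u b" if "a \<noteq> b" for a b using inj_eq[OF permutes_inj[OF u]] that by simp
  have less: "u a < u x" if "a \<in> {1..<x}" for a
    using not_in_supportD[OF x(3), of a x] that x(1) inj[of a x] by force
  have greater: "u x < u b" if "b \<in> {x<..n}" for b
    using not_in_supportD[OF x(2), of x b] that x(1) inj[of x b] by force
  have "u ` {1..<x} = {1..<u x}"
  proof
    show "u ` {1..<x} \<subseteq> {1..<u x}"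
      using less permutes_in_image[OF u] x(1) by fastforce
    show "{1..<u x} \<subseteq> u ` {1..<x}"
    proof
      fix y assume y: "y \<in> {1..<u x}"
      moreover have "u x \<in> {1..n}" using permutes_in_image[OF u] x(1) by blast
      ultimately have "y \<in> u ` {1..n}" using permutes_image[OF u] by auto
      then obtain a where a: "a \<in> {1..n}" "y = u a" by blast
      then have "\<not> x \<le> a" using greater[of a] y by (cases "a = x") auto
      then show "y \<in> u ` {1..<x}" using a by auto
    qed
  qed
  then have "card {1..<u x} = card {1..<x}"
    using card_image[OF permutes_inj_on[OF u]] by metis
  moreover have "1 \<le> u x" using permutes_in_image[OF u, of x] x(1) by auto
  ultimately show ?thesis using x(1) by simp linarith
qed

lemma permutes_eq_if_order_eq:
  fixes \<pi> \<rho> :: "nat \<Rightarrow> nat"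
  assumes \<pi>: "\<pi> permutes {1..m}" and \<rho>: "\<rho> permutes {1..m}"
    and eq: "\<And>a b. a \<in> {1..m} \<Longrightarrow> b \<in> {1..m} \<Longrightarrow> \<pi> a < \<pi> b \<longleftrightarrow> \<rho> a < \<rho> b"
  shows "\<pi> = \<rho>"
proof
  fix a show "\<pi> a = \<rho> a"
  proof (cases "a \<in> {1..m}")
    case True
    have rank: "\<tau> a = Suc (card {b \<in> {1..m}. \<tau> b < \<tau> a})" if \<tau>: "\<tau> permutes {1..m}" for \<tau> :: "nat \<Rightarrow> nat"
    proof -
      have ta: "\<tau> a \<in> {1..m}" using permutes_in_image[OF \<tau>] True by blast
      have "\<tau> ` {b \<in> {1..m}. \<tau> b < \<tau> a} = {c \<in> \<tau> ` {1..m}. c < \<tau> a}" by blast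
      also have "\<dots> = {1..<\<tau> a}" using permutes_image[OF \<tau>] ta by auto
      finally have "card {b \<in> {1..m}. \<tau> b < \<tau> a} = card {1..<\<tau> a}"
        using card_image[OF permutes_inj_on[OF \<tau>]] by metis
      then show ?thesis using ta by simp
    qed
    have "{b \<in> {1..m}. \<pi> b < \<pi> a} = {b \<in> {1..m}. \<rho> b < \<rho> a}"
      using eq[OF _ True] by (intro Collect_cong conj_cong refl)
    then show ?thesis using rank[OF \<pi>] rank[OF \<rho>] by simp
  next
    case False
    then show ?thesis using \<pi> \<rho> by (simp add: permutes_def)
  qed
qed

text \<open>M contains both letters of each simple transposition in the support of \<sigma>, so
  every u below \<sigma> moves only letters of M. Relabelling M increasingly therefore loses
  nothing, and it turns \<sigma> into \<pi> because a permutation is determined by its order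
  pattern.\<close>

lemma toroidal_if_toroidal_pattern_on_support:
  assumes ix: "strict_mono_on {1..m} ix" "ix ` {1..m} = M" and M: "M \<subseteq> {1..n}"
    and \<sigma>: "\<sigma> permutes {1..n}" and \<pi>: "\<pi> permutes {1..m}"
    and pat: "\<And>a b. a \<in> {1..m} \<Longrightarrow> b \<in> {1..m} \<Longrightarrow> \<sigma> (ix a) < \<sigma> (ix b) \<longleftrightarrow> \<pi> a < \<pi> b"
    and supp: "\<And>k. k \<in> support n \<sigma> \<Longrightarrow> k \<in> M \<and> k + 1 \<in> M"
    and tor: "toroidal (bruhat_graph m \<pi>)"
  shows "toroidal (bruhat_graph n \<sigma>)"
proof -
  have inj: "inj_on ix {1..m}" using strict_mono_on_imp_inj_on[OF ix(1)] .
  have less: "ix a < ix b \<longleftrightarrow> a < b" if "a \<in> {1..m}" "b \<in> {1..m}" for a b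
    using that strict_mono_on_less[OF ix(1)] by auto
  have bij: "bij_betw ix {1..m} M" using inj ix(2) by (simp add: bij_betw_def)
  define g where "g = inv_into {1..m} ix"
  have g: "bij_betw g M {1..m}" unfolding g_def by (rule bij_betw_inv_into[OF bij])
  have gix: "g (ix a) = a" if "a \<in> {1..m}" for a using inj that by (simp add: g_def)
  have ixg: "ix (g x) = x" if "x \<in> M" for x using that ix(2) by (simp add: g_def f_inv_into_f)
  have g_mem: "g x \<in> {1..m}" if "x \<in> M" for x using bij_betwE[OF g] that by blast
  define \<psi> where "\<psi> u a = (if a \<in> {1..m} then g (u (ix a)) else a)" for u a
  have outside: "u x = x" if u: "bruhat_le n u \<sigma>" and x: "x \<notin> M" for u x
  proof (cases "x \<in> {1..n}")
    case True
    have "x \<notin> support n \<sigma>" "x - 1 \<notin> support n \<sigma>" using supp[of x] supp[of "x - 1"] x True by auto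
    then show ?thesis
      using fixed_outside_support[OF bruhat_le_permutes[OF u \<sigma>] True] support_bruhat_le[OF u] by blast
  next
    case False
    then show ?thesis using bruhat_le_permutes[OF u \<sigma>] by (simp add: permutes_def)
  qed
  have u_perm: "u permutes M" if "bruhat_le n u \<sigma>" for u
    using bruhat_le_permutes[OF that \<sigma>] outside[OF that]
    by (metis permutes_superset Diff_iff)
  have \<psi>_perm: "\<psi> u permutes {1..m}" if "bruhat_le n u \<sigma>" for u
  proof -
    have perm: "(\<lambda>x. if x \<in> {1..m} then g (u (inv_into M g x)) else x) permutes {1..m}"
      by (rule permutes_bij_inv_into[OF u_perm[OF that] g])
    have "inv_into M g a = ix a" if "a \<in> {1..m}" for a
      using g gix[OF that] that ix(2) by (intro inv_into_f_eq) (auto simp: bij_betw_def)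
    then have "(\<lambda>x. if x \<in> {1..m} then g (u (inv_into M g x)) else x) = \<psi> u"
      unfolding \<psi>_def by (intro ext) simp
    with perm show ?thesis by simp
  qed
  have ix_mem: "ix a \<in> M" if "a \<in> {1..m}" for a using that ix(2) by blast
  have ix_\<psi>: "ix (\<psi> u a) = u (ix a)" if "bruhat_le n u \<sigma>" "a \<in> {1..m}" for u a
    using ixg permutes_in_image[OF u_perm[OF that(1)]] ix_mem[OF that(2)] that(2) by (simp add: \<psi>_def)
  have \<psi>_mem: "\<psi> u a \<in> {1..m}" if "bruhat_le n u \<sigma>" "a \<in> {1..m}" for u a
    using permutes_in_image[OF \<psi>_perm[OF that(1)]] that(2) by blast
  have \<psi>_less: "\<psi> u a < \<psi> u b \<longleftrightarrow> u (ix a) < u (ix b)"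
    if "bruhat_le n u \<sigma>" "a \<in> {1..m}" "b \<in> {1..m}" for u a b
    using less[OF \<psi>_mem[OF that(1,2)] \<psi>_mem[OF that(1,3)]] ix_\<psi>[OF that(1,2)] ix_\<psi>[OF that(1,3)] by simp
  have \<psi>_transpose: "\<psi> (u \<circ> Transposition.transpose (ix i) (ix j)) = \<psi> u \<circ> Transposition.transpose i j"
    if ij: "i \<in> {1..m}" "j \<in> {1..m}" for u i j
  proof
    fix a show "\<psi> (u \<circ> Transposition.transpose (ix i) (ix j)) a = (\<psi> u \<circ> Transposition.transpose i j) a"
    proof (cases "a \<in> {1..m}")
      case True
      then have "Transposition.transpose (ix i) (ix j) (ix a) = ix (Transposition.transpose i j a)"
        using ij inj_on_eq_iff[OF inj] by (simp add: transpose_eq_if)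
      moreover have "Transposition.transpose i j a \<in> {1..m}" using True ij by (simp add: transpose_eq_if)
      ultimately show ?thesis using True by (simp add: \<psi>_def)
    next
      case False
      then have "Transposition.transpose i j a = a" using ij by (auto simp: transpose_eq_if)
      then show ?thesis using False by (simp only: \<psi>_def o_apply if_False)
    qed
  qed
  have top: "\<psi> \<sigma> = \<pi>"
  proof -
    have "bruhat_le n \<sigma> \<sigma>" by (rule bruhat_le_refl)
    note * = \<psi>_perm[OF this] \<psi>_less[OF this]
    have "\<psi> \<sigma> a < \<psi> \<sigma> b \<longleftrightarrow> \<pi> a < \<pi> b" if "a \<in> {1..m}" "b \<in> {1..m}" for a b
      using *(2) pat that by simp
    then show ?thesis using permutes_eq_if_order_eq[OF *(1) \<pi>] by blast
  qed
  show ?thesis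
  proof (rule toroidal_bruhat_graph_embedding[OF \<sigma> \<pi> _ _ _ tor])
    show "\<psi> \<sigma> = \<pi>" by (rule top)
    show "inj_on \<psi> {u. bruhat_le n u \<sigma>}"
    proof (rule inj_onI, rule ext)
      fix u v x assume uv: "u \<in> {u. bruhat_le n u \<sigma>}" "v \<in> {u. bruhat_le n u \<sigma>}" "\<psi> u = \<psi> v"
      show "u x = v x"
      proof (cases "x \<in> M")
        case True
        have "u x = ix (\<psi> u (g x))" "v x = ix (\<psi> v (g x))"
          using ix_\<psi>[of u "g x"] ix_\<psi>[of v "g x"] uv(1,2) g_mem[OF True] ixg[OF True] by simp_all
        then show ?thesis using uv(3) by simp
      next
        case False
        then show ?thesis using outside[of u x] outside[of v x] uv(1,2) by simp
      qed
    qed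
    show "bruhat_step m (\<psi> u) (\<psi> v)" if st: "bruhat_step n u v" and v: "bruhat_le n v \<sigma>" for u v
    proof -
      obtain i j where ij: "i \<in> {1..n}" "j \<in> {1..n}" "i < j" "v j < v i" "u = v \<circ> Transposition.transpose i j"
        using st unfolding bruhat_step_iff by blast
      \<comment> \<open>The inversion straddles the cut after i and the cut after j - 1, so
        \<open>supp\<close> puts i and j into M.\<close>
      have "i \<in> support n v" "j - 1 \<in> support n v"
        using supportI[OF ij(1,2) _ _ ij(4)] ij(3) by auto
      then have "i \<in> support n \<sigma>" "j - 1 \<in> support n \<sigma>" using support_bruhat_le[OF v] by blast+
      then have "i \<in> M" "j \<in> M" using supp[of i] supp[of "j - 1"] ij(3) by simp_all
      define a b where "a = g i" and "b = g j"
      have ab: "a \<in> {1..m}" "b \<in> {1..m}" "i = ix a" "j = ix b"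
        unfolding a_def b_def using g_mem ixg \<open>i \<in> M\<close> \<open>j \<in> M\<close> by simp_all
      show ?thesis
        unfolding ij(5) ab(3,4) \<psi>_transpose[OF ab(1,2)]
        using ij(3,4) less[OF ab(1,2)] \<psi>_less[OF v ab(2,1)] unfolding ab(3,4)
        by (intro bruhat_stepI \<psi>_perm v ab(1,2)) simp_all
    qed
  qed
qed

lemma not_toroidal_if_large_support:
  assumes \<pi>: "\<pi> permutes {1..n}" and card: "card (support n \<pi>) \<ge> 5"
  shows "\<not> toroidal (bruhat_graph n \<pi>)"
proof -
  obtain F where F0: "\<forall>A\<subseteq>support n \<pi>. bruhat_le n (F A) \<pi> \<and> support n (F A) = A \<and>
      (\<forall>k\<in>support n \<pi> - A. bruhat_step n (F A) (F (insert k A)))"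
    by (rule exE[OF ex_cube_below[OF \<pi>]])
  have F: "bruhat_le n (F A) \<pi>" "support n (F A) = A"
    "k \<in> support n \<pi> - A \<Longrightarrow> bruhat_step n (F A) (F (insert k A))"
    if "A \<subseteq> support n \<pi>" for A k
    using F0 that by simp_all
  show ?thesis
  proof (rule not_toroidal_if_cube[OF card])
    \<comment> \<open>The prescribed supports make \<open>support n\<close> a left inverse of
      F.\<close>
    show "inj_on F (Pow (support n \<pi>))"
      by (rule inj_on_inverseI[where g = "support n"]) (simp add: F(2))
    show "F ` Pow (support n \<pi>) \<subseteq> verts (bruhat_graph n \<pi>)"
      using F(1) bruhat_le_permutes[OF F(1) \<pi>] by (auto simp: verts_bruhat_graph)
    show "{F A, F (insert k A)} \<in> undirected_edges (bruhat_graph n \<pi>)"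
      if A: "A \<subseteq> support n \<pi>" "k \<in> support n \<pi> - A" for A k
    proof -
      have "bruhat_step n (F A) (F (insert k A))" "bruhat_le n (F (insert k A)) \<pi>"
        using F(1,3) A by simp_all
      then show ?thesis
        unfolding undirected_edges_bruhat_graph[OF \<pi>]
        by (intro image_eqI[of _ _ "(F A, F (insert k A))"]) simp_all
    qed
  qed
qed

theorem corollary4p3:
  fixes n :: nat and \<sigma> :: "nat \<Rightarrow> nat"
  assumes "n \<ge> 1" and "\<sigma> permutes {1..n}"
  shows "toroidal (bruhat_graph n \<sigma>) \<longleftrightarrow>
    (\<forall>m \<pi>. m \<le> 10 \<and> \<pi> permutes {1..m} \<and> \<not> toroidal (bruhat_graph m \<pi>)
       \<longrightarrow> avoids_pattern n \<sigma> m \<pi>)"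
proof
  assume "toroidal (bruhat_graph n \<sigma>)"
  then show "\<forall>m \<pi>. m \<le> 10 \<and> \<pi> permutes {1..m} \<and> \<not> toroidal (bruhat_graph m \<pi>)
       \<longrightarrow> avoids_pattern n \<sigma> m \<pi>"
    using toroidal_pattern[OF assms(2)] by blast
next
  assume "\<forall>m \<pi>. m \<le> 10 \<and> \<pi> permutes {1..m} \<and> \<not> toroidal (bruhat_graph m \<pi>)
       \<longrightarrow> avoids_pattern n \<sigma> m \<pi>"
  then have tor: "toroidal (bruhat_graph m \<pi>)"
    if "m \<le> 10" "\<pi> permutes {1..m}" "contains_pattern n \<sigma> m \<pi>" for m \<pi>
    using that by blast
  have pattern: "\<exists>ix \<pi>. strict_mono_on {1..card M} ix \<and> ix ` {1..card M} = M \<and> \<pi> permutes {1..card M} \<and>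
      (\<forall>a\<in>{1..card M}. \<forall>b\<in>{1..card M}. \<sigma> (ix a) < \<sigma> (ix b) \<longleftrightarrow> \<pi> a < \<pi> b) \<and>
      toroidal (bruhat_graph (card M) \<pi>)"
    if M: "M \<subseteq> {1..n}" "card M \<le> 10" for M
  proof -
    obtain ix \<pi> where *: "strict_mono_on {1..card M} ix" "ix ` {1..card M} = M" "\<pi> permutes {1..card M}"
      "\<And>a b. a \<in> {1..card M} \<Longrightarrow> b \<in> {1..card M} \<Longrightarrow> \<sigma> (ix a) < \<sigma> (ix b) \<longleftrightarrow> \<pi> a < \<pi> b"
      by (rule ex_pattern_on[OF assms(2) M(1)]) (rule that)
    have "contains_pattern n \<sigma> (card M) \<pi>"
      unfolding contains_pattern_def using * M(1) by (intro exI[of _ ix]) simp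
    then show ?thesis
      using * tor[OF M(2) *(3)] by (intro exI[of _ ix] exI[of _ \<pi>]) simp
  qed
  show "toroidal (bruhat_graph n \<sigma>)"
  proof (cases "card (support n \<sigma>) \<ge> 5")
    case True
    then have "5 \<le> card (pattern_support {1..n} \<sigma>)" by (simp only: pattern_support_interval)
    from ex_small_pattern_support[OF finite_atLeastAtMost this]
    obtain M where M: "M \<subseteq> {1..n}" "card M \<le> 10" "5 \<le> card (pattern_support M \<sigma>)" by auto
    obtain ix \<pi> where *: "strict_mono_on {1..card M} ix" "ix ` {1..card M} = M" "\<pi> permutes {1..card M}"
      "\<forall>a\<in>{1..card M}. \<forall>b\<in>{1..card M}. \<sigma> (ix a) < \<sigma> (ix b) \<longleftrightarrow> \<pi> a < \<pi> b"
      "toroidal (bruhat_graph (card M) \<pi>)"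
      using pattern[OF M(1,2)] by (elim exE conjE) (rule that)
    \<comment> \<open>The pattern on M is toroidal by hypothesis, yet its support has at least five
      elements: a contradiction.\<close>
    have "card (support (card M) \<pi>) = card (pattern_support M \<sigma>)"
      using *(4) by (intro card_support_pattern[OF *(1,2)]) blast
    then show ?thesis
      using not_toroidal_if_large_support[OF *(3)] *(5) M(3) by simp
  next
    case False
    \<comment> \<open>At most four elements k of the support, hence at most eight positions k and k
      + 1.\<close>
    define M where "M = support n \<sigma> \<union> Suc ` support n \<sigma>"
    have M: "M \<subseteq> {1..n}" using support_subset[of n \<sigma>] by (fastforce simp: M_def)
    have "card M \<le> card (support n \<sigma>) + card (Suc ` support n \<sigma>)"
      unfolding M_def by (rule card_Un_le)
    then have card10: "card M \<le> 10" using False card_image_le[OF finite_support, of Suc n \<sigma>] by simp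
    obtain ix \<pi> where *: "strict_mono_on {1..card M} ix" "ix ` {1..card M} = M" "\<pi> permutes {1..card M}"
      "\<forall>a\<in>{1..card M}. \<forall>b\<in>{1..card M}. \<sigma> (ix a) < \<sigma> (ix b) \<longleftrightarrow> \<pi> a < \<pi> b"
      "toroidal (bruhat_graph (card M) \<pi>)"
      using pattern[OF M card10] by (elim exE conjE) (rule that)
    have supp: "k \<in> M \<and> k + 1 \<in> M" if "k \<in> support n \<sigma>" for k
      using that by (simp add: M_def)
    show ?thesis
      using *(4) supp
      by (intro toroidal_if_toroidal_pattern_on_support[OF *(1,2) M assms(2) *(3) _ _ *(5)]) blast+
  qed
qed

end
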